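(* Let $H:(0,\infty)\to\mathbb C^{2n\times2n}$ be locally integrable with $H\ge0$ a.e. and $0$ a regular endpoint. Let $\alpha=(\alpha_1\ \alpha_2),\beta=(\beta_1\ \beta_2)\in\mathbb C^{n\times2n}$ with $\alpha\alpha^*=I=\beta\beta^*$, $\alpha J\alpha^*=0=\beta J\beta^*$. Suppose that for some $L>0$, $H(x)=P:=\begin{pmatrix}\beta_1^*\beta_1&\beta_1^*\beta_2\\ \beta_2^*\beta_1&\beta_2^*\beta_2\end{pmatrix}$ for $x>L$. Let $\mathcal S=\{(f,g)\in L_H^2(0,\infty)^2: f$ has an absolutely continuous representative $f_0$ with $Jf_0'=-Hg$ a.e. on $(0,\infty)$ and $\alpha f_0(0)=0\}$. Then, under the identification $L^2_H(0,\infty)=L^2_H(0,L)\oplus L^2_H(L,\infty)$, $\mathcal S=\mathcal S^{\alpha,\beta}(0,L)\oplus\{(0,g):g\in L^2_H(L,\infty)\}$. If $H$ is definite on $(0,L)$, then both deficiency indices of $H$ on $(0,\infty)$ equal $n$, the operator parts of $\mathcal S$ and $\mathcal S^{\alpha,\beta}(0,L)$ coincide, and the $m$ functions of $\mathcal S$ and $\mathcal S^{\alpha,\beta}(0,L)$ are the same.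
   Context: $J=\begin{pmatrix}0&-I_n\\ I_n&0\end{pmatrix}$. Regular endpoint $0$: $H\in L^1(0,c)$ for some $c>0$. $H$ definite on an interval: $H(x)v=0$ a.e. there implies $v=0$. $L_H^2(I)$: measurable $f$ with $\int_I f^*Hf<\infty$ modulo null functions. $\mathcal S^{\alpha,\beta}(0,L)=\{(f,g)\in L^2_H(0,L)^2:f$ has an absolutely continuous representative $f_0$ with $Jf_0'=-Hg$ a.e. on $(0,L)$, $\alpha f_0(0)=0=\beta f_0(L)\}$. Deficiency indices: $\dim\ker(\mathcal T\mp i)$ for the maximal relation $\mathcal T$ on $(0,\infty)$. The operator part of a self-adjoint relation $\mathcal R$ is $\mathcal R\cap(\overline{D(\mathcal R)}\oplus\overline{D(\mathcal R)})$. With $u,v$ the matrix solutions of $Ju'=-zHu$, $u(0,z)=-J\alpha^*$, $v(0,z)=\alpha^*$: the $m$ function of $\mathcal S$ at $z\notin\mathbb R$ is the unique $m(z)$ with the columns of $v+um(z)$ in $L^2_H(0,\infty)$, and the $m$ function of $\mathcal S^{\alpha,\beta}(0,L)$ is the unique $m(z)$ with $\beta(v(L,z)+u(L,z)m(z))=0$. *)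

theory Defs
  imports "HOL-Analysis.Analysis"
begin

text \<open>Vectors in C^(2n) are indexed by the type 'n + 'n (first block / second block),
  where CARD('n) = n. Matrices are HOL-Analysis nested vectors.\<close>

definition cadj :: "complex ^'m::finite ^'k::finite \<Rightarrow> complex ^'k ^'m" where
  "cadj M = (\<chi> i j. cnj (M $ j $ i))"

definition Jmat :: "complex ^('n::finite + 'n) ^('n + 'n)" where
  "Jmat = (\<chi> i j. (case (i, j) of
            (Inl a, Inr b) \<Rightarrow> (if a = b then -1 else 0)
          | (Inr a, Inl b) \<Rightarrow> (if a = b then 1 else 0)
          | _ \<Rightarrow> 0))"

definition hform :: "complex ^'m::finite ^'m \<Rightarrow> complex ^'m \<Rightarrow> complex" where
  "hform M v = (\<Sum>i\<in>UNIV. cnj (v $ i) * ((M *v v) $ i))"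

definition psd :: "complex ^'m::finite ^'m \<Rightarrow> bool" where
  "psd M \<longleftrightarrow> (\<forall>v. Im (hform M v) = 0 \<and> Re (hform M v) \<ge> 0)"

definition abs_cont_on :: "real set \<Rightarrow> (real \<Rightarrow> 'a::real_normed_vector) \<Rightarrow> bool" where
  "abs_cont_on S f \<longleftrightarrow>
     (\<forall>\<epsilon>>0. \<exists>\<delta>>0. \<forall>(m::nat) (a::nat\<Rightarrow>real) b.
        (\<forall>i<m. a i \<le> b i \<and> {a i..b i} \<subseteq> S) \<and>
        (\<forall>i<m. \<forall>j<m. i \<noteq> j \<longrightarrow> b i \<le> a j \<or> b j \<le> a i) \<and>
        (\<Sum>i<m. b i - a i) < \<delta>
        \<longrightarrow> (\<Sum>i<m. norm (f (b i) - f (a i))) < \<epsilon>)"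

definition loc_abs_cont_on :: "real set \<Rightarrow> (real \<Rightarrow> 'a::real_normed_vector) \<Rightarrow> bool" where
  "loc_abs_cont_on S f \<longleftrightarrow> (\<forall>a b. {a..b} \<subseteq> S \<longrightarrow> abs_cont_on {a..b} f)"

definition in_L2H :: "(real \<Rightarrow> complex ^'m::finite ^'m) \<Rightarrow> real set \<Rightarrow> (real \<Rightarrow> complex ^'m) \<Rightarrow> bool" where
  "in_L2H H I f \<longleftrightarrow> f \<in> borel_measurable (restrict_space lebesgue I) \<and>
     (\<integral>\<^sup>+x\<in>I. ennreal (Re (hform (H x) (f x))) \<partial>lebesgue) < \<infinity>"

definition null_H :: "(real \<Rightarrow> complex ^'m::finite ^'m) \<Rightarrow> real set \<Rightarrow> (real \<Rightarrow> complex ^'m) \<Rightarrow> bool" where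
  "null_H H I f \<longleftrightarrow> (AE x in lebesgue. x \<in> I \<longrightarrow> hform (H x) (f x) = 0)"

definition normsq_H :: "(real \<Rightarrow> complex ^'m::finite ^'m) \<Rightarrow> real set \<Rightarrow> (real \<Rightarrow> complex ^'m) \<Rightarrow> ennreal" where
  "normsq_H H I f = (\<integral>\<^sup>+x\<in>I. ennreal (Re (hform (H x) (f x))) \<partial>lebesgue)"

section \<open>Relations (on representatives; all relations below are saturated w.r.t. null functions)\<close>

definition canon_eq :: "(real \<Rightarrow> complex ^('n::finite+'n) ^('n+'n)) \<Rightarrow> real set
     \<Rightarrow> (real \<Rightarrow> complex ^('n+'n)) \<Rightarrow> (real \<Rightarrow> complex ^('n+'n)) \<Rightarrow> bool" where
  "canon_eq H I f0 g \<longleftrightarrow> (AE x in lebesgue. x \<in> I \<longrightarrow>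
      (\<exists>d. (f0 has_vector_derivative d) (at x) \<and> Jmat *v d = - (H x *v g x)))"

definition Tmax :: "(real \<Rightarrow> complex ^('n::finite+'n) ^('n+'n))
     \<Rightarrow> ((real \<Rightarrow> complex ^('n+'n)) \<times> (real \<Rightarrow> complex ^('n+'n))) set" where
  "Tmax H = {(f, g). in_L2H H {0<..} f \<and> in_L2H H {0<..} g \<and>
      (\<exists>f0. loc_abs_cont_on {0<..} f0 \<and> null_H H {0<..} (\<lambda>x. f x - f0 x) \<and>
            canon_eq H {0<..} f0 g)}"

text \<open>the relation S on (0,\<infinity>) with boundary condition \<alpha> f0(0) = 0. Since 0 is regular,
  f0 extends to an absolutely continuous function on every [0,b].\<close>
definition S_half :: "(real \<Rightarrow> complex ^('n::finite+'n) ^('n+'n)) \<Rightarrow> complex ^('n+'n) ^'n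
     \<Rightarrow> ((real \<Rightarrow> complex ^('n+'n)) \<times> (real \<Rightarrow> complex ^('n+'n))) set" where
  "S_half H \<alpha> = {(f, g). in_L2H H {0<..} f \<and> in_L2H H {0<..} g \<and>
      (\<exists>f0. loc_abs_cont_on {0..} f0 \<and> null_H H {0<..} (\<lambda>x. f x - f0 x) \<and>
            canon_eq H {0<..} f0 g \<and> \<alpha> *v f0 0 = 0)}"

definition S_ab :: "(real \<Rightarrow> complex ^('n::finite+'n) ^('n+'n)) \<Rightarrow> complex ^('n+'n) ^'n
     \<Rightarrow> complex ^('n+'n) ^'n \<Rightarrow> real
     \<Rightarrow> ((real \<Rightarrow> complex ^('n+'n)) \<times> (real \<Rightarrow> complex ^('n+'n))) set" where
  "S_ab H \<alpha> \<beta> L = {(f, g). in_L2H H {0<..<L} f \<and> in_L2H H {0<..<L} g \<and>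
      (\<exists>f0. abs_cont_on {0..L} f0 \<and> null_H H {0<..<L} (\<lambda>x. f x - f0 x) \<and>
            canon_eq H {0<..<L} f0 g \<and> \<alpha> *v f0 0 = 0 \<and> \<beta> *v f0 L = 0)}"

definition clos_dom :: "(real \<Rightarrow> complex ^'m::finite ^'m) \<Rightarrow> real set
     \<Rightarrow> ((real \<Rightarrow> complex ^'m) \<times> (real \<Rightarrow> complex ^'m)) set \<Rightarrow> (real \<Rightarrow> complex ^'m) set" where
  "clos_dom H I R = {h. in_L2H H I h \<and>
      (\<forall>\<epsilon>>0. \<exists>(p, q)\<in>R. normsq_H H I (\<lambda>x. h x - p x) < ennreal \<epsilon>)}"

definition op_part :: "(real \<Rightarrow> complex ^'m::finite ^'m) \<Rightarrow> real set
     \<Rightarrow> ((real \<Rightarrow> complex ^'m) \<times> (real \<Rightarrow> complex ^'m)) set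
     \<Rightarrow> ((real \<Rightarrow> complex ^'m) \<times> (real \<Rightarrow> complex ^'m)) set" where
  "op_part H I R = {(f, g) \<in> R. f \<in> clos_dom H I R \<and> g \<in> clos_dom H I R}"

definition quot_dim :: "(real \<Rightarrow> complex ^'m::finite ^'m) \<Rightarrow> real set \<Rightarrow> (real \<Rightarrow> complex ^'m) set \<Rightarrow> nat \<Rightarrow> bool" where
  "quot_dim H I K d \<longleftrightarrow> (\<exists>fs :: nat \<Rightarrow> real \<Rightarrow> complex ^'m.
      (\<forall>i<d. fs i \<in> K) \<and>
      (\<forall>c :: nat \<Rightarrow> complex. null_H H I (\<lambda>x. \<Sum>i<d. c i *s fs i x) \<longrightarrow> (\<forall>i<d. c i = 0)) \<and>
      (\<forall>f\<in>K. \<exists>c :: nat \<Rightarrow> complex. null_H H I (\<lambda>x. f x - (\<Sum>i<d. c i *s fs i x))))"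

definition def_index :: "(real \<Rightarrow> complex ^('n::finite+'n) ^('n+'n)) \<Rightarrow> complex \<Rightarrow> nat \<Rightarrow> bool" where
  "def_index H z d \<longleftrightarrow> quot_dim H {0<..} {f. (f, (\<lambda>x. z *s f x)) \<in> Tmax H} d"

definition is_msol :: "(real \<Rightarrow> complex ^('n::finite+'n) ^('n+'n)) \<Rightarrow> complex
     \<Rightarrow> complex ^'n ^('n+'n) \<Rightarrow> (real \<Rightarrow> complex ^'n ^('n+'n)) \<Rightarrow> bool" where
  "is_msol H z u0 u \<longleftrightarrow> loc_abs_cont_on {0..} u \<and> u 0 = u0 \<and>
     (AE x in lebesgue. x \<in> {0<..} \<longrightarrow>
        (\<exists>d. (u has_vector_derivative d) (at x) \<and> Jmat ** d = - (\<chi> i j. z * (H x ** u x) $ i $ j)))"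

definition m_fun_S :: "(real \<Rightarrow> complex ^('n::finite+'n) ^('n+'n)) \<Rightarrow> complex ^('n+'n) ^'n
     \<Rightarrow> complex \<Rightarrow> complex ^'n ^'n \<Rightarrow> bool" where
  "m_fun_S H \<alpha> z m \<longleftrightarrow> (\<exists>u v. is_msol H z (- (Jmat ** cadj \<alpha>)) u \<and> is_msol H z (cadj \<alpha>) v \<and>
      (\<forall>k. in_L2H H {0<..} (\<lambda>x. column k (v x + u x ** m))))"

definition m_fun_ab :: "(real \<Rightarrow> complex ^('n::finite+'n) ^('n+'n)) \<Rightarrow> complex ^('n+'n) ^'n
     \<Rightarrow> complex ^('n+'n) ^'n \<Rightarrow> real \<Rightarrow> complex \<Rightarrow> complex ^'n ^'n \<Rightarrow> bool" where
  "m_fun_ab H \<alpha> \<beta> L z m \<longleftrightarrow> (\<exists>u v. is_msol H z (- (Jmat ** cadj \<alpha>)) u \<and> is_msol H z (cadj \<alpha>) v \<and>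
      \<beta> ** (v L + u L ** m) = 0)"

end

theory Submission
  imports Defs
begin

text \<open>On the tail \<open>H = \<beta>\<^sup>* \<beta>\<close>, and \<open>\<beta> J \<beta>\<^sup>* = 0\<close> makes \<open>\<beta> f\<close> constant along every solution of
  \<open>J f' = - H g\<close>. Since \<open>f\<^sup>* H f = |\<beta> f|\<^sup>2\<close> there, square integrability on the half line is equivalent to
  \<open>\<beta> f(L) = 0\<close>, so the tail acts exactly like the boundary condition \<open>\<beta>\<close> at \<open>L\<close>. Conversely a solution
  with \<open>\<beta> f(L) = 0\<close> extends by \<open>f(x) = f(L) + J \<beta>\<^sup>* \<integral> \<beta> g\<close> over \<open>(L, x)\<close>. Hence the eigenspaces and the
  \<open>m\<close> functions are read off the condition \<open>\<beta> Y(L,z) c = 0\<close> for the fundamental matrix \<open>Y\<close>, and the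
  \<open>m\<close> function exists because a regular self-adjoint problem has no nonreal eigenvalue.\<close>

section \<open>Absolutely continuous functions and the fundamental theorem of calculus\<close>

text \<open>The kernel of \<beta> is exactly the range of \<open>Jmat ** cadj \<beta>\<close>. This
  fact of linear algebra supplies the direction in which solutions may drift on the tail, the
  dimension n of the space of square integrable solutions for every z, and the vanishing of the
  boundary terms in Green's identity. The summand {(0,g)} arises because f is a null function beyond
  L while g is unrestricted there: it moves the representative only inside the kernel of \<beta>.
  Passing to operator parts removes this summand, since the functions in the closure of the domain
  are again null beyond L. The equation holds only almost everywhere and absolute continuity is the
  epsilon-delta notion, so both directions of Lebesgue's fundamental theorem of calculus are needed:
  differentiating an integral to construct solutions, integrating a derivative to obtain conserved
  quantities. Definiteness acts through a single fact: a solution that is null on (0,L) vanishes. It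
  makes n solutions independent modulo null functions and excludes nonreal eigenvalues.\<close>

lemma integral_has_vector_derivative_AE:
  fixes f :: "real \<Rightarrow> 'b::euclidean_space"
  assumes int: "\<And>b. f integrable_on {a..b}"
  shows "AE x in lebesgue. a < x \<longrightarrow> ((\<lambda>x. integral {a..x} f) has_vector_derivative f x) (at x)"
proof -
  \<comment> \<open>Extension by zero, because the differentiation theorem for one-sided averages
    asks for integrability over every interval.\<close>
  define g where "g = (\<lambda>x. if x \<in> {a..} then f x else 0)"
  have gint: "g integrable_on {c..d}" for c d
  proof -
    have "{a..} \<inter> {c..d} = {max a c..d}" by auto
    moreover have "f integrable_on {max a c..d}"
      by (rule integrable_subinterval_real[OF int[of d]]) auto
    ultimately show ?thesis unfolding g_def integrable_restrict_Int by simp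
  qed
  \<comment> \<open>The theorem treats averages to the right of a point. Left averages of
    \<open>g\<close> are right averages of the reflected function; hence a second exceptional set,
    which enters through its mirror image.\<close>
  have gint': "(\<lambda>x. g (- x)) integrable_on {c..d}" for c d
    using Henstock_Kurzweil_Integration.integrable_reflect_real[of g "-c" "-d"] gint by simp
  obtain N1 where N1: "negligible N1" "\<And>x e. \<lbrakk>x \<notin> N1; 0 < e\<rbrakk> \<Longrightarrow>
       \<exists>d>0. \<forall>h. 0 < h \<and> h < d \<longrightarrow> norm (integral {x..x + h} g /\<^sub>R h - g x) < e"
    using integrable_ccontinuous_explicit[of g] gint by auto
  obtain N2 where N2: "negligible N2" "\<And>x e. \<lbrakk>x \<notin> N2; 0 < e\<rbrakk> \<Longrightarrow>
       \<exists>d>0. \<forall>h. 0 < h \<and> h < d \<longrightarrow> norm (integral {x..x + h} (\<lambda>t. g (-t)) /\<^sub>R h - g (-x)) < e"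
    using integrable_ccontinuous_explicit[of "\<lambda>t. g (-t)"] gint' by auto
  have "negligible (uminus ` N2)"
    by (rule negligible_differentiable_image_negligible[OF order_refl N2(1)])
      (simp add: linear_imp_differentiable_on linear_uminus)
  then have "negligible (N1 \<union> uminus ` N2)" using N1(1) by simp
  then have ae: "AE x in lebesgue. x \<notin> N1 \<union> uminus ` N2"
    unfolding negligible_iff_null_sets by (rule AE_not_in)
  have main: "((\<lambda>x. integral {a..x} f) has_vector_derivative f x) (at x)"
    if x: "a < x" "x \<notin> N1 \<union> uminus ` N2" for x
  proof -
    have gf: "integral {c..d} g = integral {c..d} f" if "a \<le> c" for c d
      by (rule integral_cong) (use that in \<open>auto simp: g_def\<close>)
    have gx: "g x = f x" using x by (simp add: g_def)
    have "\<exists>d>0. \<forall>y. norm (y - x) < d \<longrightarrow>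
        norm (integral {a..y} f - integral {a..x} f - (y - x) *\<^sub>R f x) \<le> e * norm (y - x)"
      if e: "e > 0" for e
    proof -
      obtain d1 where d1: "d1 > 0" "\<And>h. 0 < h \<Longrightarrow> h < d1 \<Longrightarrow> norm (integral {x..x + h} g /\<^sub>R h - g x) < e"
        using N1(2)[OF _ e, of x] x by auto
      have "- x \<notin> N2" using x by force
      then obtain d2 where d2: "d2 > 0" "\<And>h. 0 < h \<Longrightarrow> h < d2 \<Longrightarrow>
          norm (integral {-x..-x + h} (\<lambda>t. g (-t)) /\<^sub>R h - g x) < e"
        using N2(2)[OF _ e, of "-x"] by auto
      have scale: "norm (I - h *\<^sub>R w) \<le> e * h" if "0 < h" "norm (I /\<^sub>R h - w) < e" for I w :: 'b and h
      proof -
        have "I - h *\<^sub>R w = h *\<^sub>R (I /\<^sub>R h - w)" using that by (simp add: algebra_simps)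
        then have "norm (I - h *\<^sub>R w) = h * norm (I /\<^sub>R h - w)" using that by simp
        then show ?thesis using that by (simp add: mult.commute)
      qed
      show ?thesis
      proof (intro exI[of _ "min (min d1 d2) (x - a)"] conjI allI impI)
        show "0 < min (min d1 d2) (x - a)" using d1 d2 x by auto
        fix y assume y: "norm (y - x) < min (min d1 d2) (x - a)"
        consider "y = x" | "y > x" | "y < x" by linarith
        then show "norm (integral {a..y} f - integral {a..x} f - (y - x) *\<^sub>R f x) \<le> e * norm (y - x)"
        proof cases
          case 2
          have "integral {a..x} f + integral {x..y} f = integral {a..y} f"
            using 2 x by (intro Henstock_Kurzweil_Integration.integral_combine int) auto
          then have "integral {a..y} f - integral {a..x} f = integral {x..x + (y - x)} g"
            using x by (subst gf) (auto simp: algebra_simps)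
          with scale[OF _ d1(2)[of "y - x"]] 2 y show ?thesis by (simp add: gx)
        next
          case 3
          then have ay: "a < y" using y by (auto simp: abs_if split: if_splits)
          have "integral {a..y} f + integral {y..x} f = integral {a..x} f"
            using 3 ay by (intro Henstock_Kurzweil_Integration.integral_combine int) auto
          moreover have "integral {-x..-x + (x - y)} (\<lambda>t. g (-t)) = integral {y..x} f"
            using Henstock_Kurzweil_Integration.integral_reflect_real[of x y g] gf[of y x] ay by simp
          ultimately have "norm (integral {a..y} f - integral {a..x} f - (y - x) *\<^sub>R f x)
              = norm (integral {-x..-x + (x - y)} (\<lambda>t. g (-t)) - (x - y) *\<^sub>R f x)"
            by (metis (no_types, lifting) add_diff_cancel_left' diff_diff_eq minus_diff_eq
                norm_minus_commute diff_minus_eq_add diff_add_eq scaleR_minus_left add.commute)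
          with scale[OF _ d2(2)[of "x - y"]] 3 y show ?thesis by (simp add: gx)
        qed auto
      qed
    qed
    then show ?thesis
      unfolding has_vector_derivative_def has_derivative_at_alt
      by (simp add: bounded_linear_scaleR_left)
  qed
  show ?thesis
    using ae by eventually_elim (use main in blast)
qed

text \<open>Two of the intervals share at most endpoints, so the overlaps are negligible. It turns a
  sum over a family from the definition of absolute continuity into one integral: of the remainder
  of a truncation, and of the constant 1 to compare a total length with a measure.\<close>

lemma has_integral_nonoverlapping:
  fixes a b :: "nat \<Rightarrow> real" and f :: "real \<Rightarrow> 'b::banach"
  assumes ov: "\<And>i j. i < m \<Longrightarrow> j < m \<Longrightarrow> i \<noteq> j \<Longrightarrow> b i \<le> a j \<or> b j \<le> a i"
    and int: "\<And>i. i < m \<Longrightarrow> f integrable_on {a i..b i}"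
  shows "(f has_integral (\<Sum>i<m. integral {a i..b i} f)) (\<Union>i<m. {a i..b i})"
proof (rule has_integral_UN)
  show "pairwise (\<lambda>i i'. negligible ({a i..b i} \<inter> {a i'..b i'})) {..<m}"
  proof (rule pairwiseI)
    fix i j assume "i \<in> {..<m}" "j \<in> {..<m}" "i \<noteq> j"
    then have "b i \<le> a j \<or> b j \<le> a i" using ov by auto
    then have "{a i..b i} \<inter> {a j..b j} \<subseteq> {b i, b j}" by auto
    then show "negligible ({a i..b i} \<inter> {a j..b j})"
      by (rule negligible_subset[rotated]) simp
  qed
qed (use int integrable_integral in auto)

text \<open>Truncation: \<open>t k\<close> is bounded by \<open>k\<close> and contributes at most
  \<open>k\<close> times the total length, while the remainder \<open>r\<close> has a small integral
  over the whole interval once \<open>k\<close> is large, by dominated convergence.\<close>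

lemma abs_cont_on_integral:
  fixes f :: "real \<Rightarrow> 'b::euclidean_space"
  assumes f: "f absolutely_integrable_on {a..b}"
  shows "abs_cont_on {a..b} (\<lambda>x. integral {a..x} f)"
  unfolding abs_cont_on_def
proof (intro allI impI)
  fix e :: real assume e: "e > 0"
  define t where "t = (\<lambda>k x. min (norm (f x)) (real k))"
  have nf: "(\<lambda>x. norm (f x)) absolutely_integrable_on {a..b}"
    using set_integrable_norm[OF f] by simp
  have tint: "t k absolutely_integrable_on {a..b}" for k
    unfolding t_def
    by (rule absolutely_integrable_min_1) (use nf in \<open>auto simp: absolutely_integrable_on_def\<close>)
  have lim: "(\<lambda>k. integral {a..b} (t k)) \<longlonglongrightarrow> integral {a..b} (\<lambda>x. norm (f x))"
  proof (rule dominated_convergence(2))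
    show "t k integrable_on {a..b}" for k using tint set_lebesgue_integral_eq_integral(1) by blast
    show "(\<lambda>x. norm (f x)) integrable_on {a..b}" using nf set_lebesgue_integral_eq_integral(1) by blast
    show "norm (t k x) \<le> norm (f x)" for k x by (auto simp: t_def)
    show "(\<lambda>k. t k x) \<longlonglongrightarrow> norm (f x)" for x
    proof (rule tendsto_eventually)
      obtain n where "norm (f x) \<le> real n" using real_arch_simple by blast
      then show "\<forall>\<^sub>F k in sequentially. t k x = norm (f x)"
        unfolding eventually_sequentially t_def
        by (intro exI[of _ n]) (auto simp: min_def)
    qed
  qed
  obtain k where k: "integral {a..b} (\<lambda>x. norm (f x)) - integral {a..b} (t k) < e / 2"
  proof -
    from LIMSEQ_D[OF lim, of "e/2"] e obtain k where
      "norm (integral {a..b} (t k) - integral {a..b} (\<lambda>x. norm (f x))) < e/2" by auto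
    then show thesis by (intro that[of k]) (auto simp: abs_if split: if_splits)
  qed
  define r where "r = (\<lambda>x. norm (f x) - t k x)"
  have rint: "r integrable_on {a..b}"
    unfolding r_def using tint nf set_lebesgue_integral_eq_integral(1) by (blast intro: integrable_diff)
  have r0: "0 \<le> r x" for x by (auto simp: r_def t_def)
  have rlt: "integral {a..b} r < e / 2"
    using k unfolding r_def
    by (subst Henstock_Kurzweil_Integration.integral_diff)
      (use tint nf set_lebesgue_integral_eq_integral(1) in auto)
  show "\<exists>\<delta>>0. \<forall>(m::nat) (c::nat \<Rightarrow> real) d.
          (\<forall>i<m. c i \<le> d i \<and> {c i..d i} \<subseteq> {a..b}) \<and>
          (\<forall>i<m. \<forall>j<m. i \<noteq> j \<longrightarrow> d i \<le> c j \<or> d j \<le> c i) \<and>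
          (\<Sum>i<m. d i - c i) < \<delta> \<longrightarrow>
          (\<Sum>i<m. norm (integral {a..d i} f - integral {a..c i} f)) < e"
  proof (intro exI[of _ "e / (2 * (real k + 1))"] conjI allI impI)
    \<comment> \<open>The bounded part receives \<open>e / 2\<close>, the remainder the other half;
      the summand 1 covers the case \<open>k = 0\<close>.\<close>
    show "0 < e / (2 * (real k + 1))" using e by simp
    fix m :: nat and c d :: "nat \<Rightarrow> real"
    assume *: "(\<forall>i<m. c i \<le> d i \<and> {c i..d i} \<subseteq> {a..b}) \<and>
          (\<forall>i<m. \<forall>j<m. i \<noteq> j \<longrightarrow> d i \<le> c j \<or> d j \<le> c i) \<and>
          (\<Sum>i<m. d i - c i) < e / (2 * (real k + 1))"
    have sub: "{c i..d i} \<subseteq> {a..b}" "c i \<le> d i" if "i < m" for i using * that by auto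
    have fsub: "f absolutely_integrable_on {c i..d i}" if "i < m" for i
      using set_integrable_subset[OF f] sub[OF that] by auto
    have rsub: "r integrable_on {c i..d i}" if "i < m" for i
      using integrable_on_subinterval[OF rint sub(1)[OF that]] .
    have le: "norm (integral {a..d i} f - integral {a..c i} f)
        \<le> integral {c i..d i} r + real k * (d i - c i)" if i: "i < m" for i
    proof -
      have "a \<le> c i" "d i \<le> b" using sub[OF i] by auto
      then have eq: "integral {a..c i} f + integral {c i..d i} f = integral {a..d i} f"
        using sub[OF i] f integrable_on_subinterval[of f "{a..b}" a "d i"]
        by (intro Henstock_Kurzweil_Integration.integral_combine) (auto simp: absolutely_integrable_on_def)
      then have "norm (integral {a..d i} f - integral {a..c i} f) = norm (integral {c i..d i} f)"
        by (simp add: eq[symmetric])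
      also have "\<dots> \<le> integral {c i..d i} (\<lambda>x. r x + real k)"
      proof (rule Henstock_Kurzweil_Integration.integral_norm_bound_integral)
        show "f integrable_on {c i..d i}" using fsub[OF i] by (simp add: absolutely_integrable_on_def)
        show "(\<lambda>x. r x + real k) integrable_on {c i..d i}"
          by (intro integrable_add rsub i integrable_const_ivl)
        show "norm (f x) \<le> r x + real k" for x by (auto simp: r_def t_def)
      qed
      also have "\<dots> = integral {c i..d i} r + real k * (d i - c i)"
        by (subst Henstock_Kurzweil_Integration.integral_add)
          (use rsub[OF i] sub[OF i] in \<open>auto simp: mult.commute\<close>)
      finally show ?thesis .
    qed
    have "(\<Sum>i<m. norm (integral {a..d i} f - integral {a..c i} f))
       \<le> (\<Sum>i<m. integral {c i..d i} r + real k * (d i - c i))"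
      by (rule sum_mono) (use le in auto)
    also have "\<dots> = (\<Sum>i<m. integral {c i..d i} r) + real k * (\<Sum>i<m. d i - c i)"
      by (simp add: sum.distrib sum_distrib_left)
    also have "(\<Sum>i<m. integral {c i..d i} r) \<le> integral {a..b} r"
    proof -
      have h: "(r has_integral (\<Sum>i<m. integral {c i..d i} r)) (\<Union>i<m. {c i..d i})"
        by (rule has_integral_nonoverlapping) (use * rsub in auto)
      then have "(\<Sum>i<m. integral {c i..d i} r) = integral (\<Union>i<m. {c i..d i}) r"
        by (simp add: integral_unique)
      also have "\<dots> \<le> integral {a..b} r"
      proof (rule integral_subset_le)
        show "(\<Union>i<m. {c i..d i}) \<subseteq> {a..b}" using sub(1) by blast
      qed (use h rint r0 in auto)
      finally show ?thesis .
    qed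
    also have "real k * (\<Sum>i<m. d i - c i) \<le> real k * (e / (2 * (real k + 1)))"
      using * by (intro mult_left_mono) auto
    also have "\<dots> \<le> e / 2" using e by (simp add: field_simps)
    finally show "(\<Sum>i<m. norm (integral {a..d i} f - integral {a..c i} f)) < e"
      using rlt by simp
  qed
qed

text \<open>Off the exceptional null set the Riemann sums are controlled by differentiability; the intervals
  tagged in the null set lie in an open set of small measure and are controlled by absolute continuity.\<close>

lemma has_integral_abs_cont_on:
  fixes f :: "real \<Rightarrow> 'b::real_normed_vector"
  assumes ab: "a \<le> b" and ac: "abs_cont_on {a..b} f"
    and der: "AE x in lebesgue. x \<in> {a<..<b} \<longrightarrow> (f has_vector_derivative g x) (at x)"
  shows "(g has_integral (f b - f a)) {a..b}"
proof -
  obtain N0 where N0: "N0 \<in> null_sets lebesgue"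
    "{x. \<not> (x \<in> {a<..<b} \<longrightarrow> (f has_vector_derivative g x) (at x))} \<subseteq> N0"
    using der by (auto simp: eventually_ae_filter)
  \<comment> \<open>Differentiability is known only in the interior, so the endpoints join the
    exceptional set. Setting the integrand to zero on \<open>N\<close> leaves a cell tagged there
    with nothing but its increment of \<open>f\<close>; the spike at the end restores
    \<open>g\<close>.\<close>
  define N where "N = insert a (insert b N0)"
  have negN: "negligible N" using N0(1) by (simp add: N_def negligible_iff_null_sets)
  define g' where "g' = (\<lambda>x. if x \<in> N then 0 else g x)"
  have dg: "(f has_vector_derivative g' x) (at x)" if "x \<in> {a..b}" "x \<notin> N" for x
  proof -
    have "x \<in> {a<..<b}" "x \<notin> N0" using that by (auto simp: N_def)
    then show ?thesis using N0(2) that(2) unfolding g'_def by auto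
  qed
  have "(g' has_integral (f b - f a)) {a..b}"
  proof (cases "a = b")
    case False
    then have ab': "a < b" using ab by simp
    show ?thesis
      unfolding has_integral_factor_content_real
    proof (intro allI impI)
      fix e :: real assume e: "e > 0"
      \<comment> \<open>The admissible error is \<open>e * (b - a)\<close>: one half for the cells
        tagged in \<open>N\<close>, the other half for the remaining ones.\<close>
      define e' where "e' = e * (b - a) / 2"
      have e': "e' > 0" using e ab' by (simp add: e'_def)
      obtain \<delta> where \<delta>: "\<delta> > 0" "\<forall>(m::nat) c d. (\<forall>i<m. c i \<le> d i \<and> {c i..d i} \<subseteq> {a..b}) \<and>
          (\<forall>i<m. \<forall>j<m. i \<noteq> j \<longrightarrow> d i \<le> c j \<or> d j \<le> c i) \<and>
          (\<Sum>i<m. d i - c i) < \<delta> \<longrightarrow> (\<Sum>i<m. norm (f (d i) - f (c i))) < e'"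
        using ac[unfolded abs_cont_on_def, THEN spec, THEN mp, OF e'] by (elim exE conjE) (rule that)
      obtain U where U: "open U" "N \<subseteq> U" "U \<in> lmeasurable" "measure lebesgue U < \<delta>"
      proof -
        obtain T where T: "open T" "N \<subseteq> T" "T - N \<in> lmeasurable" "emeasure lebesgue (T - N) < ennreal \<delta>"
          using sets_lebesgue_outer_open[OF _ \<delta>(1), of N] negN negligible_imp_sets by blast
        have T': "T = (T - N) \<union> N" using T by auto
        have Tm: "T \<in> lmeasurable"
          by (subst T') (intro fmeasurable.Un T negligible_imp_measurable negN)
        have "emeasure lebesgue T = emeasure lebesgue (T - N)"
          by (subst T', rule emeasure_Un_null_set)
            (use T negN in \<open>auto simp: negligible_iff_null_sets\<close>)
        then have "emeasure lebesgue T < ennreal \<delta>" using T by simp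
        then have "measure lebesgue T < \<delta>"
          using Tm \<delta>(1) by (simp add: emeasure_eq_measure2 ennreal_less_iff)
        with T Tm show thesis by (intro that)
      qed
      have "\<forall>x. \<exists>d>0. x \<in> {a..b} - N \<longrightarrow>
           (\<forall>y. norm (y-x) < d \<longrightarrow> norm (f y - f x - (y-x) *\<^sub>R g' x) \<le> e / 2 * norm (y-x))"
      proof
        fix x
        show "\<exists>d>0. x \<in> {a..b} - N \<longrightarrow>
           (\<forall>y. norm (y-x) < d \<longrightarrow> norm (f y - f x - (y-x) *\<^sub>R g' x) \<le> e / 2 * norm (y-x))"
        proof (cases "x \<in> {a..b} - N")
          case True
          then show ?thesis
            using dg[of x, unfolded has_vector_derivative_def has_derivative_at_alt] half_gt_zero[OF e]
            by blast
        qed (auto intro: exI[of _ 1])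
      qed
      then obtain d where d: "\<And>x. d x > 0" "\<And>x y. x \<in> {a..b} - N \<Longrightarrow> norm (y-x) < d x \<Longrightarrow>
          norm (f y - f x - (y-x) *\<^sub>R g' x) \<le> e / 2 * norm (y-x)"
        by metis
      define \<gamma> where "\<gamma> = (\<lambda>x. if x \<in> N then U else ball x (d x))"
      have "gauge \<gamma>" using U d by (auto simp: gauge_def \<gamma>_def)
      moreover have "norm ((\<Sum>(x, K)\<in>p. measure lborel K *\<^sub>R g' x) - (f b - f a)) \<le> e * measure lborel {a..b}"
        if p: "p tagged_division_of {a..b}" "\<gamma> fine p" for p
      proof -
        have fin: "finite p" using p by auto
        have pK: "\<exists>u v. K = {u..v} \<and> u \<le> v \<and> u \<le> x \<and> x \<le> v \<and> a \<le> u \<and> v \<le> b" if xK: "(x,K) \<in> p" for x K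
        proof -
          obtain u v where uv: "K = cbox u v" using tagged_division_ofD(4)[OF p(1) xK] by blast
          have "x \<in> K" "K \<subseteq> {a..b}" using tagged_division_ofD(2,3)[OF p(1) xK] by auto
          then show ?thesis using uv by (intro exI[of _ u] exI[of _ v]) auto
        qed
        \<comment> \<open>Degenerate cells have increment zero and are dropped. Distinct members of
          \<open>B\<close> then have disjoint nonempty interiors, which orders their endpoints as
          the definition of absolute continuity demands.\<close>
        define B where "B = {xK \<in> p. fst xK \<in> N \<and> Inf (snd xK) < Sup (snd xK)}"
        have finB: "finite B" using fin by (simp add: B_def)
        define D where "D = (\<lambda>K. f (Sup K) - f (Inf K))"
        have pt: "norm (measure lborel K *\<^sub>R g' x - D K)
            \<le> e / 2 * (Sup K - Inf K) + (if (x,K) \<in> B then norm (D K) else 0)" if xK: "(x,K) \<in> p" for x K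
        proof -
          obtain u v where uv: "K = {u..v}" "u \<le> v" "u \<le> x" "x \<le> v" "a \<le> u" "v \<le> b"
            using pK[OF xK] by blast
          have SI: "Sup K = v" "Inf K = u" "measure lborel K = v - u" using uv by auto
          show ?thesis
          proof (cases "x \<in> N")
            case True
            then have eq: "norm (measure lborel K *\<^sub>R g' x - D K) = norm (D K)" by (simp add: g'_def)
            have "0 \<le> e / 2 * (Sup K - Inf K)" using e uv SI by simp
            moreover have "(x,K) \<in> B \<or> D K = 0"
              using xK uv(2) SI True by (cases "u = v") (auto simp: B_def D_def)
            ultimately show ?thesis unfolding eq by auto
          next
            case False
            have "K \<subseteq> ball x (d x)" using fineD[OF p(2) xK] False by (simp add: \<gamma>_def)
            moreover have "u \<in> K" "v \<in> K" using uv by auto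
            ultimately have "u \<in> ball x (d x)" "v \<in> ball x (d x)" by blast+
            then have uvb: "norm (u - x) < d x" "norm (v - x) < d x"
              by (simp_all add: dist_norm norm_minus_commute)
            have xab: "x \<in> {a..b} - N" using uv False by auto
            have "measure lborel K *\<^sub>R g' x - D K = (f u - f x - (u-x) *\<^sub>R g' x) - (f v - f x - (v-x) *\<^sub>R g' x)"
              by (simp add: D_def SI algebra_simps)
            also have "norm \<dots> \<le> e / 2 * norm (u-x) + e / 2 * norm (v-x)"
              by (rule order_trans[OF norm_triangle_ineq4 add_mono[OF d(2)[OF xab uvb(1)] d(2)[OF xab uvb(2)]]])
            also have "\<dots> = e / 2 * (v - u)" using uv by (simp add: field_simps)
            finally show ?thesis using False by (auto simp: SI B_def)
          qed
        qed
        have sumB: "(\<Sum>xK\<in>B. norm (D (snd xK))) < e'"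
        proof -
          obtain h where h: "bij_betw h {0..<card B} B"
            using ex_bij_betw_nat_finite[OF finB] by blast
          define c where "c = (\<lambda>i. Inf (snd (h i)))"
          define dd where "dd = (\<lambda>i. Sup (snd (h i)))"
          have hB: "h i \<in> B" if "i < card B" for i using h that by (auto simp: bij_betw_def)
          have hi: "snd (h i) = {c i..dd i} \<and> c i < dd i \<and> a \<le> c i \<and> dd i \<le> b \<and> {c i..dd i} \<subseteq> U"
            if i: "i < card B" for i
          proof -
            obtain x K where xK: "h i = (x,K)" by fastforce
            then have "(x,K) \<in> p" "x \<in> N" "Inf K < Sup K" using hB[OF i] by (auto simp: B_def)
            moreover have "K \<subseteq> U" using fineD[OF p(2) calculation(1)] calculation(2) by (simp add: \<gamma>_def)
            ultimately show ?thesis using pK[of x K] xK by (auto simp: c_def dd_def)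
          qed
          have ov: "dd i \<le> c j \<or> dd j \<le> c i" if ij: "i < card B" "j < card B" "i \<noteq> j" for i j
          proof -
            have "h i \<noteq> h j" using h ij by (auto simp: bij_betw_def inj_on_def)
            moreover have "h i \<in> p" "h j \<in> p" using hB ij by (auto simp: B_def)
            ultimately have "interior (snd (h i)) \<inter> interior (snd (h j)) = {}"
              using tagged_division_ofD(5)[OF p(1), of "fst (h i)" "snd (h i)" "fst (h j)" "snd (h j)"] by auto
            then have disj: "{c i<..<dd i} \<inter> {c j<..<dd j} = {}" using hi ij by simp
            show ?thesis
            proof (rule ccontr)
              assume "\<not> ?thesis"
              then have "max (c i) (c j) < min (dd i) (dd j)" using hi ij by auto
              then obtain z where "max (c i) (c j) < z" "z < min (dd i) (dd j)" using dense by blast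
              then have "z \<in> {c i<..<dd i} \<inter> {c j<..<dd j}" by auto
              with disj show False by simp
            qed
          qed
          have sub: "(\<Union>i<card B. {c i..dd i}) \<subseteq> U" using hi by blast
          have "((\<lambda>_. 1::real) has_integral (\<Sum>i<card B. integral {c i..dd i} (\<lambda>_. 1))) (\<Union>i<card B. {c i..dd i})"
            by (rule has_integral_nonoverlapping[OF ov integrable_const_ivl])
          moreover have "(\<Sum>i<card B. integral {c i..dd i} (\<lambda>_. 1::real)) = (\<Sum>i<card B. dd i - c i)"
          proof (rule sum.cong)
            fix i assume "i \<in> {..<card B}"
            then have "c i < dd i" using hi by blast
            then show "integral {c i..dd i} (\<lambda>_. 1::real) = dd i - c i" by simp
          qed simp
          ultimately have "((\<lambda>_. 1::real) has_integral (\<Sum>i<card B. dd i - c i)) (\<Union>i<card B. {c i..dd i})" by simp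
          note hU = this
          then have "(\<Union>i<card B. {c i..dd i}) \<in> lmeasurable"
            unfolding lmeasurable_iff_integrable_on by blast
          then have "(\<Sum>i<card B. dd i - c i) = measure lebesgue (\<Union>i<card B. {c i..dd i})"
            using integral_unique[OF hU] by (simp only: lmeasure_integral)
          also have "\<dots> \<le> measure lebesgue U"
            by (rule measure_mono_fmeasurable[OF sub _ U(3)]) auto
          finally have "(\<Sum>i<card B. dd i - c i) < \<delta>" using U by simp
          moreover have "\<forall>i<card B. c i \<le> dd i \<and> {c i..dd i} \<subseteq> {a..b}"
          proof (intro allI impI)
            fix i assume "i < card B"
            then have "c i < dd i \<and> a \<le> c i \<and> dd i \<le> b" using hi by blast
            then show "c i \<le> dd i \<and> {c i..dd i} \<subseteq> {a..b}" by auto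
          qed
          ultimately have "(\<Sum>i<card B. norm (f (dd i) - f (c i))) < e'"
            by (intro \<delta>(2)[THEN spec[of _ "card B"], THEN spec[of _ c], THEN spec[of _ dd], THEN mp] conjI)
              (use ov in blast)+
          then have "(\<Sum>i\<in>{0..<card B}. norm (D (snd (h i)))) < e'"
            by (simp add: c_def dd_def D_def atLeast0LessThan)
          then show ?thesis
            using sum.reindex_bij_betw[OF h, of "\<lambda>xK. norm (D (snd xK))"] by simp
        qed
        have "(\<Sum>(x, K)\<in>p. measure lborel K *\<^sub>R g' x) - (f b - f a) = (\<Sum>(x, K)\<in>p. measure lborel K *\<^sub>R g' x - D K)"
          using additive_tagged_division_1[OF ab p(1), of f]
          by (simp add: D_def sum_subtractf case_prod_unfold)
        also have "norm \<dots> \<le> (\<Sum>xK\<in>p. e / 2 * (Sup (snd xK) - Inf (snd xK)) + (if xK \<in> B then norm (D (snd xK)) else 0))"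
        proof (rule sum_norm_le)
          fix xK assume "xK \<in> p"
          then show "norm (case xK of (x, K) \<Rightarrow> measure lborel K *\<^sub>R g' x - D K)
             \<le> e / 2 * (Sup (snd xK) - Inf (snd xK)) + (if xK \<in> B then norm (D (snd xK)) else 0)"
            using pt[of "fst xK" "snd xK"] by (simp add: case_prod_unfold)
        qed
        also have "\<dots> = e / 2 * (\<Sum>(x,K)\<in>p. Sup K - Inf K) + (\<Sum>xK\<in>B. norm (D (snd xK)))"
        proof -
          have "(\<Sum>xK\<in>p. if xK \<in> B then norm (D (snd xK)) else 0) = (\<Sum>xK\<in>B. norm (D (snd xK)))"
          proof (rule sum.mono_neutral_cong_right[OF fin])
            show "B \<subseteq> p" by (auto simp: B_def)
          qed auto
          then show ?thesis by (simp only: sum.distrib sum_distrib_left case_prod_unfold)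
        qed
        also have "(\<Sum>(x,K)\<in>p. Sup K - Inf K) = b - a"
          using additive_tagged_division_1[OF ab p(1), of "\<lambda>x. x"] by simp
        also have "e / 2 * (b - a) + (\<Sum>xK\<in>B. norm (D (snd xK))) \<le> e * measure lborel {a..b}"
          using sumB ab by (simp add: e'_def)
        finally show ?thesis .
      qed
      ultimately show "\<exists>\<gamma>. gauge \<gamma> \<and> (\<forall>\<D>. \<D> tagged_division_of {a..b} \<and> \<gamma> fine \<D> \<longrightarrow>
          norm ((\<Sum>(x, K)\<in>\<D>. measure lborel K *\<^sub>R g' x) - (f b - f a)) \<le> e * measure lborel {a..b})"
        by (intro exI[of _ \<gamma>]) simp
    qed
  qed (simp add: has_integral_refl)
  then show ?thesis
    by (rule has_integral_spike[OF negN, rotated]) (simp add: g'_def)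
qed

section \<open>Stability of absolute continuity under restriction, algebraic operations and
  stopping\<close>

lemma abs_cont_on_subset:
  assumes f: "abs_cont_on T f" and ST: "S \<subseteq> T"
  shows "abs_cont_on S f"
  unfolding abs_cont_on_def
proof (intro allI impI)
  fix e :: real assume e: "e > 0"
  obtain d where d: "d > 0" "\<forall>(m::nat) a b. (\<forall>i<m. a i \<le> b i \<and> {a i..b i} \<subseteq> T) \<and>
        (\<forall>i<m. \<forall>j<m. i \<noteq> j \<longrightarrow> b i \<le> a j \<or> b j \<le> a i) \<and>
        (\<Sum>i<m. b i - a i) < d
        \<longrightarrow> (\<Sum>i<m. norm (f (b i) - f (a i))) < e"
    using f[unfolded abs_cont_on_def, THEN spec, THEN mp, OF e] by (elim exE conjE) (rule that)
  show "\<exists>d>0. \<forall>(m::nat) a b. (\<forall>i<m. a i \<le> b i \<and> {a i..b i} \<subseteq> S) \<and>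
        (\<forall>i<m. \<forall>j<m. i \<noteq> j \<longrightarrow> b i \<le> a j \<or> b j \<le> a i) \<and>
        (\<Sum>i<m. b i - a i) < d
        \<longrightarrow> (\<Sum>i<m. norm (f (b i) - f (a i))) < e"
  proof (intro exI[of _ d] conjI allI impI d(1))
    fix m :: nat and a b :: "nat \<Rightarrow> real"
    assume "(\<forall>i<m. a i \<le> b i \<and> {a i..b i} \<subseteq> S) \<and>
        (\<forall>i<m. \<forall>j<m. i \<noteq> j \<longrightarrow> b i \<le> a j \<or> b j \<le> a i) \<and> (\<Sum>i<m. b i - a i) < d"
    moreover from this have "\<forall>i<m. a i \<le> b i \<and> {a i..b i} \<subseteq> T" using ST by fast
    ultimately show "(\<Sum>i<m. norm (f (b i) - f (a i))) < e"
      using d(2)[THEN spec[of _ m], THEN spec[of _ a], THEN spec[of _ b]] by simp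
  qed
qed

text \<open>Common source of the closure properties: for sums, Lipschitz images, linear images and
  products, the increments are controlled by those of the given functions.\<close>

lemma abs_cont_on_dominated:
  assumes f: "abs_cont_on S f" and g: "abs_cont_on S g"
    and le: "\<And>x y. x \<in> S \<Longrightarrow> y \<in> S \<Longrightarrow> norm (h x - h y) \<le> A * norm (f x - f y) + B * norm (g x - g y)"
  shows "abs_cont_on S h"
  unfolding abs_cont_on_def
proof (intro allI impI)
  fix e :: real assume e: "e > 0"
  \<comment> \<open>The coefficients may have any sign; the summand 1 makes \<open>C\<close>
    positive, so that \<open>e\<close> can be divided by it.\<close>
  define C where "C = \<bar>A\<bar> + \<bar>B\<bar> + 1"
  have C: "C > 0" "A \<le> C" "B \<le> C" by (auto simp: C_def)
  have e2: "e / (2 * C) > 0" using e C by simp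
  obtain d1 where d1: "d1 > 0" "\<forall>(m::nat) a b. (\<forall>i<m. a i \<le> b i \<and> {a i..b i} \<subseteq> S) \<and>
        (\<forall>i<m. \<forall>j<m. i \<noteq> j \<longrightarrow> b i \<le> a j \<or> b j \<le> a i) \<and>
        (\<Sum>i<m. b i - a i) < d1
        \<longrightarrow> (\<Sum>i<m. norm (f (b i) - f (a i))) < e / (2 * C)"
    using f[unfolded abs_cont_on_def, THEN spec, THEN mp, OF e2] by (elim exE conjE) (rule that)
  obtain d2 where d2: "d2 > 0" "\<forall>(m::nat) a b. (\<forall>i<m. a i \<le> b i \<and> {a i..b i} \<subseteq> S) \<and>
        (\<forall>i<m. \<forall>j<m. i \<noteq> j \<longrightarrow> b i \<le> a j \<or> b j \<le> a i) \<and>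
        (\<Sum>i<m. b i - a i) < d2
        \<longrightarrow> (\<Sum>i<m. norm (g (b i) - g (a i))) < e / (2 * C)"
    using g[unfolded abs_cont_on_def, THEN spec, THEN mp, OF e2] by (elim exE conjE) (rule that)
  show "\<exists>\<delta>>0. \<forall>(m::nat) a b. (\<forall>i<m. a i \<le> b i \<and> {a i..b i} \<subseteq> S) \<and>
        (\<forall>i<m. \<forall>j<m. i \<noteq> j \<longrightarrow> b i \<le> a j \<or> b j \<le> a i) \<and>
        (\<Sum>i<m. b i - a i) < \<delta>
        \<longrightarrow> (\<Sum>i<m. norm (h (b i) - h (a i))) < e"
  proof (intro exI[of _ "min d1 d2"] conjI allI impI)
    show "0 < min d1 d2" using d1 d2 by simp
    fix m :: nat and a b :: "nat \<Rightarrow> real"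
    assume *: "(\<forall>i<m. a i \<le> b i \<and> {a i..b i} \<subseteq> S) \<and>
        (\<forall>i<m. \<forall>j<m. i \<noteq> j \<longrightarrow> b i \<le> a j \<or> b j \<le> a i) \<and> (\<Sum>i<m. b i - a i) < min d1 d2"
    have ab: "a i \<in> S" "b i \<in> S" if "i < m" for i using * that by (auto simp: subset_iff)
    have "(\<Sum>i<m. norm (h (b i) - h (a i))) \<le> (\<Sum>i<m. C * norm (f (b i) - f (a i)) + C * norm (g (b i) - g (a i)))"
    proof (rule sum_mono)
      fix i assume "i \<in> {..<m}"
      then have "norm (h (b i) - h (a i)) \<le> A * norm (f (b i) - f (a i)) + B * norm (g (b i) - g (a i))"
        by (intro le ab) auto
      also have "\<dots> \<le> C * norm (f (b i) - f (a i)) + C * norm (g (b i) - g (a i))"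
        by (intro add_mono mult_right_mono C) auto
      finally show "norm (h (b i) - h (a i)) \<le> C * norm (f (b i) - f (a i)) + C * norm (g (b i) - g (a i))" .
    qed
    also have "\<dots> = C * (\<Sum>i<m. norm (f (b i) - f (a i))) + C * (\<Sum>i<m. norm (g (b i) - g (a i)))"
      by (simp add: sum.distrib sum_distrib_left)
    also have "\<dots> < C * (e / (2 * C)) + C * (e / (2 * C))"
    proof (rule add_strict_mono)
      show "C * (\<Sum>i<m. norm (f (b i) - f (a i))) < C * (e / (2 * C))"
        using * d1(2)[THEN spec[of _ m], THEN spec[of _ a], THEN spec[of _ b]] C
        by (intro mult_strict_left_mono) auto
      show "C * (\<Sum>i<m. norm (g (b i) - g (a i))) < C * (e / (2 * C))"
        using * d2(2)[THEN spec[of _ m], THEN spec[of _ a], THEN spec[of _ b]] C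
        by (intro mult_strict_left_mono) auto
    qed
    also have "\<dots> = e" using C by simp
    finally show "(\<Sum>i<m. norm (h (b i) - h (a i))) < e" .
  qed
qed

lemma abs_cont_on_lipschitz:
  assumes "abs_cont_on S f" "\<And>x y. x \<in> S \<Longrightarrow> y \<in> S \<Longrightarrow> norm (h x - h y) \<le> A * norm (f x - f y)"
  shows "abs_cont_on S h"
  by (rule abs_cont_on_dominated[OF assms(1) assms(1), of h A 0]) (use assms(2) in simp)

lemma abs_cont_on_add:
  assumes "abs_cont_on S f" "abs_cont_on S g"
  shows "abs_cont_on S (\<lambda>x. f x + g x)"
proof (rule abs_cont_on_dominated[OF assms, of _ 1 1])
  fix x y
  have eq: "f x + g x - (f y + g y) = (f x - f y) + (g x - g y)" by simp
  show "norm (f x + g x - (f y + g y)) \<le> 1 * norm (f x - f y) + 1 * norm (g x - g y)"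
    unfolding eq mult_1 by (rule norm_triangle_ineq)
qed

lemma abs_cont_on_ident: "abs_cont_on S (\<lambda>x::real. x)"
  unfolding abs_cont_on_def
proof (intro allI impI)
  fix e :: real assume "e > 0"
  show "\<exists>\<delta>>0. \<forall>(m::nat) a b. (\<forall>i<m. a i \<le> b i \<and> {a i..b i} \<subseteq> S) \<and>
        (\<forall>i<m. \<forall>j<m. i \<noteq> j \<longrightarrow> b i \<le> a j \<or> b j \<le> a i) \<and>
        (\<Sum>i<m. b i - a i) < \<delta>
        \<longrightarrow> (\<Sum>i<m. norm (b i - a i)) < e"
  proof (intro exI[of _ e] conjI allI impI)
    fix m :: nat and a b :: "nat \<Rightarrow> real"
    assume *: "(\<forall>i<m. a i \<le> b i \<and> {a i..b i} \<subseteq> S) \<and>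
        (\<forall>i<m. \<forall>j<m. i \<noteq> j \<longrightarrow> b i \<le> a j \<or> b j \<le> a i) \<and> (\<Sum>i<m. b i - a i) < e"
    then have "(\<Sum>i<m. norm (b i - a i)) = (\<Sum>i<m. b i - a i)"
      by (intro sum.cong) auto
    with * show "(\<Sum>i<m. norm (b i - a i)) < e" by simp
  qed fact
qed

lemma abs_cont_on_const: "abs_cont_on S (\<lambda>x. c)"
  by (rule abs_cont_on_lipschitz[OF abs_cont_on_ident, of _ _ 0]) simp

lemma abs_cont_on_imp_continuous_on:
  fixes f :: "real \<Rightarrow> 'a::real_normed_vector"
  assumes f: "abs_cont_on {a..b} f"
  shows "continuous_on {a..b} f"
  unfolding continuous_on_iff
proof (intro ballI allI impI)
  fix x e :: real assume x: "x \<in> {a..b}" and e: "e > 0"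
  obtain d where d: "d > 0" "\<forall>(m::nat) s t. (\<forall>i<m. s i \<le> t i \<and> {s i..t i} \<subseteq> {a..b}) \<and>
        (\<forall>i<m. \<forall>j<m. i \<noteq> j \<longrightarrow> t i \<le> s j \<or> t j \<le> s i) \<and>
        (\<Sum>i<m. t i - s i) < d
        \<longrightarrow> (\<Sum>i<m. norm (f (t i) - f (s i))) < e"
    using f[unfolded abs_cont_on_def, THEN spec, THEN mp, OF e] by (elim exE conjE) (rule that)
  show "\<exists>d>0. \<forall>y\<in>{a..b}. dist y x < d \<longrightarrow> dist (f y) (f x) < e"
  proof (intro exI[of _ d] conjI ballI impI)
    fix y assume y: "y \<in> {a..b}" "dist y x < d"
    show "dist (f y) (f x) < e"
    proof (cases "x \<le> y")
      case True
      then show ?thesis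
        using d(2)[THEN spec[of _ "Suc 0"], THEN spec[of _ "\<lambda>_. x"], THEN spec[of _ "\<lambda>_. y"]] x y
        by (auto simp: dist_norm)
    next
      case False
      then show ?thesis
        using d(2)[THEN spec[of _ "Suc 0"], THEN spec[of _ "\<lambda>_. y"], THEN spec[of _ "\<lambda>_. x"]] x y
        by (auto simp: dist_norm norm_minus_commute)
    qed
  qed fact
qed

text \<open>The increment of the product splits into \<open>pr (f x - f y) (g x)\<close> and
  \<open>pr (f y) (g x - g y)\<close>. The factors that are not differences are bounded, because
  both functions are continuous on a compact interval.\<close>

lemma abs_cont_on_bilinear:
  fixes f :: "real \<Rightarrow> 'a::real_normed_vector" and g :: "real \<Rightarrow> 'b::real_normed_vector"
    and pr :: "'a \<Rightarrow> 'b \<Rightarrow> 'c::real_normed_vector"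
  assumes bb: "bounded_bilinear pr" and f: "abs_cont_on {a..b} f" and g: "abs_cont_on {a..b} g"
  shows "abs_cont_on {a..b} (\<lambda>x. pr (f x) (g x))"
proof -
  interpret bounded_bilinear pr by fact
  obtain K where K: "K > 0" "\<And>u v. norm (pr u v) \<le> norm u * norm v * K"
    using pos_bounded by blast
  have "bounded (f ` {a..b})" "bounded (g ` {a..b})"
    by (intro compact_imp_bounded compact_continuous_image abs_cont_on_imp_continuous_on f g compact_Icc)+
  then obtain F G where F: "\<And>x. x \<in> {a..b} \<Longrightarrow> norm (f x) \<le> F" and G: "\<And>x. x \<in> {a..b} \<Longrightarrow> norm (g x) \<le> G"
    unfolding bounded_iff ball_simps by metis
  show ?thesis
  proof (rule abs_cont_on_dominated[OF f g, of _ "G * K" "F * K"])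
    fix x y assume xy: "x \<in> {a..b}" "y \<in> {a..b}"
    have "pr (f x) (g x) - pr (f y) (g y) = pr (f x - f y) (g x) + pr (f y) (g x - g y)"
      by (simp add: diff_left diff_right)
    also have "norm \<dots> \<le> norm (f x - f y) * norm (g x) * K + norm (f y) * norm (g x - g y) * K"
      by (intro order_trans[OF norm_triangle_ineq] add_mono K)
    also have "\<dots> \<le> norm (f x - f y) * G * K + F * norm (g x - g y) * K"
      using K xy by (intro add_mono mult_right_mono mult_left_mono F G) auto
    finally show "norm (pr (f x) (g x) - pr (f y) (g y))
        \<le> G * K * norm (f x - f y) + F * K * norm (g x - g y)" by (simp add: mult_ac)
  qed
qed

lemma abs_cont_on_linear:
  assumes "bounded_linear T" "abs_cont_on S f"
  shows "abs_cont_on S (\<lambda>x. T (f x))"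
proof -
  interpret bounded_linear T by fact
  obtain K where K: "\<And>x. norm (T x) \<le> norm x * K" using bounded by blast
  show ?thesis
    by (rule abs_cont_on_lipschitz[OF assms(2), of _ K]) (use K in \<open>simp flip: diff add: mult.commute\<close>)
qed

text \<open>The map \<open>min x L\<close> is monotone and nonexpansive, so it sends a
  nonoverlapping family to a nonoverlapping family of no larger total length. This continues a
  function beyond L by its value there.\<close>

lemma abs_cont_on_stopped:
  fixes f :: "real \<Rightarrow> 'a::real_normed_vector"
  assumes f: "abs_cont_on {a..L} f"
  shows "abs_cont_on {a..b} (\<lambda>x. f (min x L))"
proof (cases "a \<le> L")
  case True
  show ?thesis
    unfolding abs_cont_on_def
  proof (intro allI impI)
    fix e :: real assume e: "e > 0"
    obtain d where d: "d > 0" "\<forall>(m::nat) s t. (\<forall>i<m. s i \<le> t i \<and> {s i..t i} \<subseteq> {a..L}) \<and>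
          (\<forall>i<m. \<forall>j<m. i \<noteq> j \<longrightarrow> t i \<le> s j \<or> t j \<le> s i) \<and>
          (\<Sum>i<m. t i - s i) < d
          \<longrightarrow> (\<Sum>i<m. norm (f (t i) - f (s i))) < e"
      using f[unfolded abs_cont_on_def, THEN spec, THEN mp, OF e] by (elim exE conjE) (rule that)
    show "\<exists>\<delta>>0. \<forall>(m::nat) s t. (\<forall>i<m. s i \<le> t i \<and> {s i..t i} \<subseteq> {a..b}) \<and>
          (\<forall>i<m. \<forall>j<m. i \<noteq> j \<longrightarrow> t i \<le> s j \<or> t j \<le> s i) \<and>
          (\<Sum>i<m. t i - s i) < \<delta>
          \<longrightarrow> (\<Sum>i<m. norm (f (min (t i) L) - f (min (s i) L))) < e"
    proof (intro exI[of _ d] conjI allI impI)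
      fix m :: nat and s t :: "nat \<Rightarrow> real"
      assume *: "(\<forall>i<m. s i \<le> t i \<and> {s i..t i} \<subseteq> {a..b}) \<and>
          (\<forall>i<m. \<forall>j<m. i \<noteq> j \<longrightarrow> t i \<le> s j \<or> t j \<le> s i) \<and> (\<Sum>i<m. t i - s i) < d"
      have "(\<Sum>i<m. min (t i) L - min (s i) L) \<le> (\<Sum>i<m. t i - s i)"
        by (rule sum_mono) (use * in auto)
      then have "(\<Sum>i<m. min (t i) L - min (s i) L) < d" using * by auto
      moreover have "\<forall>i<m. min (s i) L \<le> min (t i) L \<and> {min (s i) L..min (t i) L} \<subseteq> {a..L}"
        using * True by auto
      moreover have "\<forall>i<m. \<forall>j<m. i \<noteq> j \<longrightarrow> min (t i) L \<le> min (s j) L \<or> min (t j) L \<le> min (s i) L"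
      proof (intro allI impI)
        fix i j assume "i < m" "j < m" "i \<noteq> j"
        then have "t i \<le> s j \<or> t j \<le> s i" using * by blast
        then show "min (t i) L \<le> min (s j) L \<or> min (t j) L \<le> min (s i) L" by linarith
      qed
      ultimately show "(\<Sum>i<m. norm (f (min (t i) L) - f (min (s i) L))) < e"
        by (intro d(2)[THEN spec[of _ m], THEN spec[of _ "\<lambda>i. min (s i) L"],
              THEN spec[of _ "\<lambda>i. min (t i) L"], THEN mp] conjI)
    qed fact
  qed
next
  case False
  show ?thesis
    by (rule abs_cont_on_lipschitz[OF abs_cont_on_const, of _ _ 0 0]) (use False in \<open>auto simp: min_def\<close>)
qed

text \<open>The form in which conserved quantities are used below: \<beta> f on the tail, the
  Wronskian of two solutions, and a solution that is annihilated by H.\<close>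

lemma abs_cont_on_constant:
  fixes f :: "real \<Rightarrow> 'b::real_normed_vector"
  assumes "a \<le> b" and "abs_cont_on {a..b} f"
    and "AE x in lebesgue. x \<in> {a<..<b} \<longrightarrow> (f has_vector_derivative 0) (at x)"
  shows "f b = f a"
proof -
  have "((\<lambda>_. 0) has_integral (f b - f a)) {a..b}"
    by (rule has_integral_abs_cont_on) (use assms in auto)
  then have "f b - f a = 0" by (rule has_integral_unique) simp
  then show ?thesis by simp
qed

section \<open>Linear systems with locally integrable coefficients\<close>

lemma loc_abs_cont_on_atLeastI:
  assumes "\<And>b. abs_cont_on {c..b} f"
  shows "loc_abs_cont_on {c..} f"
  unfolding loc_abs_cont_on_def
proof (intro allI impI)
  fix a b assume "{a..b} \<subseteq> {c..}"
  then have "{a..b} \<subseteq> {c..b}" by auto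
  then show "abs_cont_on {a..b} f" by (rule abs_cont_on_subset[OF assms])
qed

lemma absolutely_integrable_bilinear_continuous:
  fixes A :: "real \<Rightarrow> 'a::euclidean_space" and y :: "real \<Rightarrow> 'b::euclidean_space"
    and pr :: "'a \<Rightarrow> 'b \<Rightarrow> 'c::euclidean_space"
  assumes bb: "bounded_bilinear pr" and A: "A absolutely_integrable_on {a..b}" and y: "continuous_on {a..b} y"
  shows "(\<lambda>t. pr (A t) (y t)) absolutely_integrable_on {a..b}"
proof (rule absolutely_integrable_bounded_measurable_product[where h = "\<lambda>y a. pr a y"])
  show "bilinear (\<lambda>y a. pr a y)"
    using bounded_bilinear.flip[OF bb] by (simp add: bilinear_conv_bounded_bilinear)
  show "y \<in> borel_measurable (lebesgue_on {a..b})"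
    by (rule continuous_imp_measurable_on_sets_lebesgue[OF y]) simp
  show "bounded (y ` {a..b})"
    by (intro compact_imp_bounded compact_continuous_image y compact_Icc)
qed (use A in auto)

text \<open>Continuity is wanted on all of the real line because the Picard map will act on bounded
  continuous functions on \<open>UNIV\<close>. To the left of \<open>c\<close> the interval is empty
  and the integral is 0.\<close>

lemma continuous_on_integral_from:
  fixes f :: "real \<Rightarrow> 'b::euclidean_space"
  assumes f: "\<And>b. f integrable_on {c..b}"
  shows "continuous_on UNIV (\<lambda>x. integral {c..x} f)"
proof -
  have c1: "continuous_on {c..b} (\<lambda>x. integral {c..x} f)" for b
    by (rule indefinite_integral_continuous_1[OF f])
  have "continuous (at x) (\<lambda>x. integral {c..x} f)" for x
  proof (cases "x < c")
    case True
    have "eventually (\<lambda>y. y \<in> {..<c}) (at x)"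
      by (rule eventually_at_in_open') (use True in auto)
    then have "eventually (\<lambda>y. integral {c..y} f = 0) (at x)"
      by eventually_elim auto
    moreover have "integral {c..x} f = 0" using True by auto
    ultimately show ?thesis unfolding continuous_at by (simp add: tendsto_eventually)
  next
    case False
    have eq: "integral {c..y} f = integral {c..max c y} f" for y by (auto simp: max_def)
    have "continuous_on {x - 1<..<x + 1} ((\<lambda>x. integral {c..x} f) \<circ> (\<lambda>y. max c y))"
      by (intro continuous_on_compose continuous_on_subset[OF c1[of "x + 1"]] continuous_intros)
        (use False in auto)
    then have "continuous_on {x - 1<..<x + 1} (\<lambda>y. integral {c..y} f)"
      using eq by (simp add: o_def flip: eq)
    then show ?thesis by (simp add: continuous_on_eq_continuous_at)
  qed
  then show ?thesis by (simp add: continuous_at_imp_continuous_on)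
qed

text \<open>From \<open>1 - exp (- s) \<le> s\<close>. It carries absolute continuity from \<phi> to
  the weight \<open>exp (2 * \<phi> x)\<close> on bounded intervals.\<close>

lemma exp_lipschitz_bounded:
  fixes s t M :: real
  assumes "s \<le> M" "t \<le> M"
  shows "\<bar>exp (2 * s) - exp (2 * t)\<bar> \<le> 2 * exp (2 * M) * \<bar>s - t\<bar>"
proof -
  have *: "\<bar>exp (2 * s) - exp (2 * t)\<bar> \<le> 2 * exp (2 * M) * \<bar>s - t\<bar>" if "s \<le> t" "t \<le> M" for s t :: real
  proof -
    have "exp (2 * t) - exp (2 * s) = exp (2 * t) * (1 - exp (2 * (s - t)))"
      by (simp add: algebra_simps flip: exp_add)
    also have "\<dots> \<le> exp (2 * t) * (2 * (t - s))"
    proof (rule mult_left_mono)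
      show "1 - exp (2 * (s - t)) \<le> 2 * (t - s)"
        using exp_ge_add_one_self[of "2 * (s - t)"] by argo
    qed simp
    also have "\<dots> \<le> exp (2 * M) * (2 * (t - s))"
      using that by (intro mult_right_mono) auto
    also have "\<dots> = 2 * exp (2 * M) * \<bar>s - t\<bar>" using that by simp
    finally show ?thesis using that by simp
  qed
  show ?thesis
    using *[of s t] *[of t s] assms by (cases "s \<le> t") (auto simp: abs_minus_commute)
qed

text \<open>Writing \<open>Y = exp (2 \<phi>) Z\<close> with \<open>\<phi>(x)\<close> the integral of \<open>K |A|\<close> over \<open>[0, x]\<close> makes the Picard map a
  contraction with factor \<open>1/2\<close> on the whole half line at once.\<close>

lemma linear_ode_existence:
  fixes A :: "real \<Rightarrow> 'a::euclidean_space" and pr :: "'a \<Rightarrow> 'b \<Rightarrow> 'b::euclidean_space"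
  assumes bb: "bounded_bilinear pr" and A: "\<And>b. A absolutely_integrable_on {0..b}"
  obtains Y where "Y 0 = y0" "loc_abs_cont_on {0..} Y"
    "AE x in lebesgue. 0 < x \<longrightarrow> (Y has_vector_derivative pr (A x) (Y x)) (at x)"
proof -
  interpret bounded_bilinear pr by fact
  obtain K where K: "K > 0" "\<And>u v. norm (pr u v) \<le> norm u * norm v * K"
    using pos_bounded by blast
  define k where "k = (\<lambda>t. K * norm (A t))"
  have kint: "k absolutely_integrable_on {0..b}" for b
    unfolding k_def using set_integrable_norm[OF A] by simp
  have k0: "k t \<ge> 0" for t using K by (simp add: k_def)
  have kint': "k integrable_on {0..b}" for b using kint set_lebesgue_integral_eq_integral(1) by blast
  define \<phi> where "\<phi> = (\<lambda>x. integral {0..x} k)"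
  define w where "w = (\<lambda>x. exp (2 * \<phi> x))"
  have \<phi>0: "\<phi> x = 0" if "x \<le> 0" for x
  proof (cases "x = 0")
    case False then have "{0..x} = {}" using that by auto
    then show ?thesis by (simp add: \<phi>_def)
  qed (simp add: \<phi>_def)
  have \<phi>_ge: "\<phi> x \<ge> 0" for x
    unfolding \<phi>_def by (rule Henstock_Kurzweil_Integration.integral_nonneg[OF kint' k0])
  have \<phi>_cont: "continuous_on UNIV \<phi>"
    unfolding \<phi>_def by (rule continuous_on_integral_from[OF kint'])
  have w_cont: "continuous_on S w" for S
    unfolding w_def by (intro continuous_intros continuous_on_subset[OF \<phi>_cont]) auto
  have w1: "w x \<ge> 1" for x using \<phi>_ge by (simp add: w_def)
  have \<phi>_mono: "\<phi> x \<le> \<phi> y" if "x \<le> y" for x y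
    unfolding \<phi>_def by (rule integral_subset_le) (use that kint' k0 in auto)
  \<comment> \<open>The derivative of \<open>w\<close> is \<open>2 * k * w\<close>, so the integral
    of \<open>k * w\<close> is \<open>(w - 1) / 2\<close>: the 2 in the exponent is the origin of
    the contraction factor.\<close>
  have w_int: "((\<lambda>t. 2 * k t * w t) has_integral (w x - 1)) {0..x}" if x: "0 \<le> x" for x
  proof -
    have "abs_cont_on {0..x} \<phi>" unfolding \<phi>_def by (rule abs_cont_on_integral[OF kint])
    then have "abs_cont_on {0..x} w"
    proof (rule abs_cont_on_lipschitz)
      fix s t assume "s \<in> {0..x}" "t \<in> {0..x}"
      then show "norm (w s - w t) \<le> 2 * exp (2 * \<phi> x) * norm (\<phi> s - \<phi> t)"
        unfolding w_def real_norm_def by (intro exp_lipschitz_bounded \<phi>_mono) auto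
    qed
    moreover have "AE t in lebesgue. t \<in> {0<..<x} \<longrightarrow> (w has_vector_derivative 2 * k t * w t) (at t)"
      using integral_has_vector_derivative_AE[OF kint']
    proof eventually_elim
      case (elim t)
      show ?case
      proof
        assume "t \<in> {0<..<x}"
        then have "(\<phi> has_real_derivative k t) (at t)"
          using elim by (simp add: \<phi>_def has_real_derivative_iff_has_vector_derivative)
        then have "(w has_real_derivative 2 * k t * w t) (at t)"
          unfolding w_def by (auto intro!: derivative_eq_intros)
        then show "(w has_vector_derivative 2 * k t * w t) (at t)"
          by (simp add: has_real_derivative_iff_has_vector_derivative)
      qed
    qed
    ultimately have "((\<lambda>t. 2 * k t * w t) has_integral (w x - w 0)) {0..x}"
      by (rule has_integral_abs_cont_on[OF x, where f = w and g = "\<lambda>t. 2 * k t * w t"])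
    then show ?thesis by (simp add: w_def \<phi>0)
  qed
  define I where "I = (\<lambda>Z x. integral {0..x} (\<lambda>t. pr (A t) (w t *\<^sub>R apply_bcontfun Z t)))"
  have int: "(\<lambda>t. pr (A t) (w t *\<^sub>R apply_bcontfun Z t)) absolutely_integrable_on {0..b}" for Z b
    by (rule absolutely_integrable_bilinear_continuous[OF bb A]) (intro continuous_intros w_cont continuous_on_apply_bcontfun)
  have int': "(\<lambda>t. pr (A t) (w t *\<^sub>R apply_bcontfun Z t)) integrable_on {0..b}" for Z b
    using int set_lebesgue_integral_eq_integral(1) by blast
  have I_bound: "norm (exp (- 2 * \<phi> x) *\<^sub>R I Z x) \<le> norm Z / 2" for Z x
  proof (cases "0 \<le> x")
    case True
    have "((\<lambda>t. norm Z / 2 * (2 * k t * w t)) has_integral norm Z / 2 * (w x - 1)) {0..x}"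
      by (rule has_integral_mult_right[OF w_int[OF True]])
    then have h: "((\<lambda>t. k t * w t * norm Z) has_integral norm Z / 2 * (w x - 1)) {0..x}"
      by (simp add: mult_ac)
    have "norm (I Z x) \<le> integral {0..x} (\<lambda>t. k t * w t * norm Z)"
      unfolding I_def
    proof (rule Henstock_Kurzweil_Integration.integral_norm_bound_integral[OF int'])
      show "(\<lambda>t. k t * w t * norm Z) integrable_on {0..x}" using h by blast
      fix t
      have "norm (pr (A t) (w t *\<^sub>R apply_bcontfun Z t)) \<le> norm (A t) * norm (w t *\<^sub>R apply_bcontfun Z t) * K"
        by (rule K)
      also have "\<dots> = k t * w t * norm (apply_bcontfun Z t)"
        using w1[of t] by (simp add: k_def)
      also have "\<dots> \<le> k t * w t * norm Z"
        using k0[of t] w1[of t] by (intro mult_left_mono norm_bounded) auto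
      finally show "norm (pr (A t) (w t *\<^sub>R apply_bcontfun Z t)) \<le> k t * w t * norm Z" .
    qed
    also have "\<dots> = norm Z / 2 * (w x - 1)" using h by (rule integral_unique)
    also have "\<dots> \<le> norm Z / 2 * w x" by (intro mult_left_mono) auto
    finally have "exp (- 2 * \<phi> x) * norm (I Z x) \<le> exp (- 2 * \<phi> x) * (norm Z / 2 * w x)"
      by (intro mult_left_mono) auto
    also have "\<dots> = norm Z / 2" by (simp add: w_def exp_minus field_simps)
    finally show ?thesis by simp
  next
    case False
    then have "{0..x} = {}" by auto
    then show ?thesis by (simp add: I_def)
  qed
  define G where "G = (\<lambda>Z x. exp (- 2 * \<phi> x) *\<^sub>R (y0 + I Z x))"
  have G_bcontfun: "G Z \<in> bcontfun" for Z
  proof (rule bcontfun_normI)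
    have "continuous_on UNIV (I Z)"
      unfolding I_def by (rule continuous_on_integral_from[OF int'])
    then show "continuous_on UNIV (G Z)"
      unfolding G_def by (intro continuous_intros \<phi>_cont)
    fix x
    have "norm (G Z x) \<le> norm (exp (- 2 * \<phi> x) *\<^sub>R y0) + norm (exp (- 2 * \<phi> x) *\<^sub>R I Z x)"
      unfolding G_def scaleR_add_right by (rule norm_triangle_ineq)
    also have "\<dots> \<le> norm y0 + norm Z / 2"
    proof (rule add_mono[OF _ I_bound])
      have "exp (- 2 * \<phi> x) * norm y0 \<le> 1 * norm y0"
        using \<phi>_ge[of x] by (intro mult_right_mono) auto
      then show "norm (exp (- 2 * \<phi> x) *\<^sub>R y0) \<le> norm y0" by simp
    qed
    finally show "norm (G Z x) \<le> norm y0 + norm Z / 2" .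
  qed
  have "\<exists>!Z. Bcontfun (G Z) = Z"
  proof (rule banach_fix_type)
    show "\<forall>Z1 Z2. dist (Bcontfun (G Z1)) (Bcontfun (G Z2)) \<le> 1/2 * dist Z1 Z2"
    proof (intro allI dist_bound)
      fix Z1 Z2 x
      have "I Z1 x - I Z2 x = I (Z1 - Z2) x"
        unfolding I_def
        by (subst Henstock_Kurzweil_Integration.integral_diff[symmetric, OF int' int'])
          (simp add: scaleR_diff_right diff_right)
      then have "G Z1 x - G Z2 x = exp (- 2 * \<phi> x) *\<^sub>R I (Z1 - Z2) x"
        by (simp add: G_def flip: scaleR_diff_right)
      then show "dist (apply_bcontfun (Bcontfun (G Z1)) x) (apply_bcontfun (Bcontfun (G Z2)) x) \<le> 1/2 * dist Z1 Z2"
        using I_bound[of x "Z1 - Z2"] by (simp add: Bcontfun_inverse[OF G_bcontfun] dist_norm)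
    qed
  qed auto
  then obtain Z where "Bcontfun (G Z) = Z" by blast
  then have Z: "apply_bcontfun Z x = G Z x" for x
    using Bcontfun_inverse[OF G_bcontfun, of Z] by metis
  define Y where "Y = (\<lambda>x. w x *\<^sub>R apply_bcontfun Z x)"
  have Yeq: "Y = (\<lambda>x. y0 + integral {0..x} (\<lambda>t. pr (A t) (Y t)))"
  proof
    fix x
    have "Y x = (w x * exp (- 2 * \<phi> x)) *\<^sub>R (y0 + I Z x)" by (simp add: Y_def Z G_def)
    also have "w x * exp (- 2 * \<phi> x) = 1" by (simp add: w_def flip: exp_add)
    finally show "Y x = y0 + integral {0..x} (\<lambda>t. pr (A t) (Y t))" by (simp add: I_def Y_def)
  qed
  have Yint: "(\<lambda>t. pr (A t) (Y t)) absolutely_integrable_on {0..b}" for b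
    using int by (simp add: Y_def)
  have Yint': "(\<lambda>t. pr (A t) (Y t)) integrable_on {0..b}" for b
    using int' by (simp add: Y_def)
  show thesis
  proof
    show "Y 0 = y0" by (subst Yeq) simp
    show "loc_abs_cont_on {0..} Y"
      by (rule loc_abs_cont_on_atLeastI, subst Yeq)
        (rule abs_cont_on_add[OF abs_cont_on_const abs_cont_on_integral[OF Yint]])
    show "AE x in lebesgue. 0 < x \<longrightarrow> (Y has_vector_derivative pr (A x) (Y x)) (at x)"
      using integral_has_vector_derivative_AE[OF Yint']
    proof eventually_elim
      case (elim x)
      show ?case
      proof
        assume "0 < x"
        then have "((\<lambda>x. y0 + integral {0..x} (\<lambda>t. pr (A t) (Y t))) has_vector_derivative 0 + pr (A x) (Y x)) (at x)"
          using elim by (intro has_vector_derivative_add has_vector_derivative_const) auto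
        then show "(Y has_vector_derivative pr (A x) (Y x)) (at x)"
          by (subst Yeq) simp
      qed
    qed
  qed
qed

section \<open>Complex matrices and Lagrangian boundary conditions\<close>

definition cip :: "complex^'m::finite \<Rightarrow> complex^'m \<Rightarrow> complex" where
  "cip u v = (\<Sum>i\<in>UNIV. cnj (u $ i) * v $ i)"

definition cscale :: "complex \<Rightarrow> complex^'m::finite^'k::finite \<Rightarrow> complex^'m^'k" where
  "cscale z M = (\<chi> i j. z * M $ i $ j)"

lemma cscale_matrix_mult:
  "cscale z A ** B = cscale z (A ** B)" "A ** cscale z B = cscale z (A ** B)"
  by (simp_all add: vec_eq_iff cscale_def matrix_matrix_mult_def sum_distrib_left mult_ac)

lemma cscale_vector_mult: "cscale z A *v v = z *s (A *v v)"
  by (simp add: vec_eq_iff cscale_def matrix_vector_mult_def sum_distrib_left mult_ac)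

lemma cscale_minus: "cscale z (- A) = - cscale z A"
  by (simp add: vec_eq_iff cscale_def)

lemma matrix_mult_minus:
  fixes A :: "'a::comm_ring_1^'m::finite^'k::finite"
  shows "(- A) ** B = - (A ** B)" "A ** (- B) = - (A ** B)"
  by (simp_all add: vec_eq_iff matrix_matrix_mult_def sum_negf)

lemma matrix_vector_mult_minus:
  fixes A :: "'a::comm_ring_1^'m::finite^'k::finite"
  shows "(- A) *v v = - (A *v v)" "A *v (- v) = - (A *v v)"
  by (simp_all add: vec_eq_iff matrix_vector_mult_def sum_negf)

lemma matrix_vector_mult_smult:
  fixes A :: "'a::comm_ring_1^'m::finite^'k::finite"
  shows "A *v (c *s v) = c *s (A *v v)"
  by (simp add: vec_eq_iff matrix_vector_mult_def sum_distrib_left mult_ac)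

lemma bounded_bilinear_matrix_mult:
  "bounded_bilinear ((**) :: complex^'m::finite^'k::finite \<Rightarrow> complex^'p::finite^'m \<Rightarrow> complex^'p^'k)"
  unfolding bilinear_conv_bounded_bilinear[symmetric] bilinear_def
  by (auto intro!: linearI simp: vec_eq_iff matrix_matrix_mult_def sum.distrib algebra_simps
      scaleR_sum_right)

lemma bounded_bilinear_matrix_vector_mult:
  "bounded_bilinear ((*v) :: complex^'m::finite^'k::finite \<Rightarrow> complex^'m \<Rightarrow> complex^'k)"
  unfolding bilinear_conv_bounded_bilinear[symmetric] bilinear_def
  by (auto intro!: linearI simp: vec_eq_iff matrix_vector_mult_def sum.distrib algebra_simps
      scaleR_sum_right)

lemma bounded_bilinear_cip: "bounded_bilinear (cip :: complex^'m::finite \<Rightarrow> _)"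
  unfolding bilinear_conv_bounded_bilinear[symmetric] bilinear_def
  by (auto intro!: linearI simp: cip_def sum.distrib algebra_simps scaleR_sum_right)

lemma bounded_linear_cadj: "bounded_linear (cadj :: complex^'m::finite^'k::finite \<Rightarrow> _)"
  unfolding linear_conv_bounded_linear[symmetric]
  by (auto intro!: linearI simp: vec_eq_iff cadj_def)

lemma bounded_linear_cscale: "bounded_linear (cscale z :: complex^'m::finite^'k::finite \<Rightarrow> _)"
  unfolding linear_conv_bounded_linear[symmetric]
  by (auto intro!: linearI simp: vec_eq_iff cscale_def algebra_simps)

lemma cadj_simps [simp]:
  "cadj (cadj A) = A" "cadj 0 = 0" "cadj (mat 1) = mat 1" "cadj (- A) = - cadj A"
  "cadj (cscale z A) = cscale (cnj z) (cadj A)"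
  by (auto simp: vec_eq_iff cadj_def mat_def cscale_def)

lemma cadj_mult: "cadj (A ** B) = cadj B ** cadj A"
  by (simp add: vec_eq_iff cadj_def matrix_matrix_mult_def mult.commute)

lemma cip_add: "cip (u + v) w = cip u w + cip v w" "cip w (u + v) = cip w u + cip w v"
  by (simp_all add: cip_def sum.distrib algebra_simps)

lemma cip_minus: "cip (- u) w = - cip u w" "cip w (- u) = - cip w u"
  by (simp_all add: cip_def sum_negf)

lemma cip_smult: "cip (c *s u) w = cnj c * cip u w" "cip w (c *s u) = c * cip w u"
  by (simp_all add: cip_def sum_distrib_left mult_ac)

lemma cip_matrix: "cip u (A *v w) = cip (cadj A *v u) w"
proof -
  have "cip u (A *v w) = (\<Sum>i\<in>UNIV. \<Sum>j\<in>UNIV. cnj (u $ i) * (A $ i $ j * w $ j))"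
    by (simp add: cip_def matrix_vector_mult_def sum_distrib_left)
  also have "\<dots> = (\<Sum>j\<in>UNIV. \<Sum>i\<in>UNIV. cnj (u $ i) * (A $ i $ j * w $ j))"
    by (rule sum.swap)
  also have "\<dots> = cip (cadj A *v u) w"
    by (simp add: cip_def matrix_vector_mult_def cadj_def sum_distrib_left sum_distrib_right mult_ac)
  finally show ?thesis .
qed

lemma cip_self: "cip v v = of_real ((norm v)\<^sup>2)"
  by (simp add: cip_def norm_vec_def L2_set_def real_sqrt_pow2 sum_nonneg complex_norm_square[symmetric] mult.commute del: of_real_power)

lemma cip_self_eq_0: "cip v v = 0 \<longleftrightarrow> v = 0"
  by (simp add: cip_self)

lemma cip_commute: "cip u v = cnj (cip v u)"
  by (simp add: cip_def mult.commute)

lemma hform_eq_cip: "hform M v = cip v (M *v v)"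
  by (simp add: hform_def cip_def)

lemma hform_gram: "hform (cadj B ** B) v = of_real ((norm (B *v v))\<^sup>2)"
proof -
  have "hform (cadj B ** B) v = cip v (cadj B *v (B *v v))"
    by (simp add: hform_eq_cip matrix_vector_mul_assoc)
  also have "\<dots> = cip (B *v v) (B *v v)" by (simp add: cip_matrix)
  finally show ?thesis by (simp add: cip_self)
qed

lemma Re_hform_nonneg: "psd M \<Longrightarrow> 0 \<le> Re (hform M v)"
  by (simp add: psd_def)

text \<open>Polarization: \<open>psd\<close> only asserts that the quadratic form is real and
  nonnegative. Reality at \<open>u + w\<close> and at \<open>u + \<i> *s w\<close> determines the
  imaginary and the real part of the difference between the two sesquilinear expressions.\<close>

lemma psd_imp_hermitian:
  assumes "psd M"
  shows "cip u (M *v w) = cip (M *v u) w"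
proof -
  have re: "Im (hform M v) = 0" for v using assms by (simp add: psd_def)
  define a where "a = cip u (M *v w)"
  define b where "b = cip w (M *v u)"
  have 1: "hform M (u + w) = hform M u + a + b + hform M w"
    by (simp add: hform_eq_cip cip_add matrix_vector_right_distrib a_def b_def)
  have 2: "hform M (u + \<i> *s w) = hform M u + \<i> * a - \<i> * b + hform M w"
    by (simp add: hform_eq_cip cip_add cip_smult matrix_vector_right_distrib matrix_vector_mult_smult a_def b_def algebra_simps)
  have "Im a + Im b = 0" using arg_cong[OF 1, of Im] by (simp add: re)
  moreover have "Re a - Re b = 0" using arg_cong[OF 2, of Im] by (simp add: re)
  ultimately have "a = cnj b" by (simp add: complex_eq_iff)
  then show ?thesis by (simp add: a_def b_def cip_commute[of "M *v u" w])
qed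

text \<open>Moving from \<open>v\<close> in the direction \<open>w = M *v v\<close> changes the form
  by \<open>2 * t * s + t^2 * q\<close> with \<open>s\<close> the squared norm of \<open>w\<close>.
  If \<open>s\<close> were positive, a small negative \<open>t\<close> would make this
  negative.\<close>

lemma psd_hform_eq_0:
  assumes "psd M"
  shows "hform M v = 0 \<longleftrightarrow> M *v v = 0"
proof
  assume 0: "hform M v = 0"
  define w where "w = M *v v"
  define s where "s = (norm w)\<^sup>2"
  define q where "q = Re (hform M w)"
  have "0 \<le> Re (hform M (v + of_real t *s w))" for t :: real
    using assms by (simp add: psd_def)
  moreover have "hform M (v + of_real t *s w) = of_real (2 * t * s) + of_real (t^2) * hform M w" for t :: real
  proof -
    have a: "cip w (M *v v) = of_real s" by (simp add: w_def[symmetric] cip_self s_def)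
    moreover have "cip v (M *v w) = of_real s"
      using psd_imp_hermitian[OF assms, of v w] a by (simp add: w_def[symmetric] cip_self s_def)
    ultimately show ?thesis
      using 0 by (simp add: hform_eq_cip cip_add cip_smult matrix_vector_right_distrib
          matrix_vector_mult_smult algebra_simps power2_eq_square)
  qed
  moreover have "Re (of_real (2 * t * s) + of_real (t^2) * hform M w) = 2 * t * s + t^2 * q" for t :: real
    by (simp add: q_def del: of_real_mult of_real_power)
  ultimately have *: "0 \<le> 2 * t * s + t^2 * q" for t :: real
    by metis
  have q0: "0 \<le> q" using assms by (simp add: psd_def q_def)
  have "s \<le> 0"
  proof (rule ccontr)
    assume "\<not> s \<le> 0"
    then have s: "s > 0" by simp
    \<comment> \<open>With this choice the value at \<open>t = - r\<close> is
      \<open>- (r^2 * (q + 2))\<close>; the summand 1 keeps the denominator positive when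
      \<open>q = 0\<close>.\<close>
    define r where "r = s / (q + 1)"
    have s_eq: "s = r * (q + 1)" and r: "r > 0" using q0 s by (simp_all add: r_def)
    have "2 * (- r) * s + (- r)^2 * q = - (r^2 * (q + 2))"
      by (simp add: s_eq algebra_simps power2_eq_square)
    moreover have "r^2 * (q + 2) > 0" using q0 r by simp
    ultimately show False using *[of "- r"] by linarith
  qed
  then show "M *v v = 0" by (simp add: s_def w_def)
qed (simp add: hform_eq_cip cip_def)

section \<open>The matrix J and the kernels of Lagrangian boundary conditions\<close>

lemma sum_UNIV_Plus:
  fixes f :: "'a::finite + 'b::finite \<Rightarrow> 'c::comm_monoid_add"
  shows "(\<Sum>k\<in>UNIV. f k) = (\<Sum>a\<in>UNIV. f (Inl a)) + (\<Sum>b\<in>UNIV. f (Inr b))"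
  by (subst UNIV_Plus_UNIV[symmetric], subst sum.Plus) (simp_all add: o_def)

lemma Jmat_vec_nth:
  "(Jmat *v v) $ Inl a = - v $ Inr a" "(Jmat *v v) $ Inr a = v $ Inl a"
proof -
  have "(\<Sum>b\<in>UNIV. (if a = b then - 1 else 0) * v $ Inr b) = (\<Sum>b\<in>UNIV. if a = b then - v $ Inr b else 0)"
    by (rule sum.cong) auto
  then show "(Jmat *v v) $ Inl a = - v $ Inr a"
    by (simp add: matrix_vector_mult_def Jmat_def sum_UNIV_Plus)
  have "(\<Sum>b\<in>UNIV. (if a = b then 1 else 0) * v $ Inl b) = (\<Sum>b\<in>UNIV. if a = b then v $ Inl b else 0)"
    by (rule sum.cong) auto
  then show "(Jmat *v v) $ Inr a = v $ Inl a"
    by (simp add: matrix_vector_mult_def Jmat_def sum_UNIV_Plus)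
qed

lemma Jmat_Jmat_vec: "Jmat *v (Jmat *v v) = - v"
  unfolding vec_eq_iff
proof
  fix i show "(Jmat *v (Jmat *v v)) $ i = (- v) $ i" by (cases i) (simp_all add: Jmat_vec_nth)
qed

lemma Jmat_mult_Jmat: "Jmat ** Jmat = - mat 1"
  by (simp add: matrix_eq Jmat_Jmat_vec matrix_vector_mult_minus flip: matrix_vector_mul_assoc)

lemma cadj_Jmat: "cadj Jmat = - Jmat"
  by (auto simp: vec_eq_iff Jmat_def cadj_def split: sum.splits)

text \<open>Stack \<beta> on top of \<gamma> = \<beta> J. The hypotheses say that the rows of this
  square matrix \<open>U\<close> are orthonormal; hence its columns are too, and
  \<open>cadj U ** U = mat 1\<close> written in blocks is the claim.\<close>

lemma lagrangian_decomposition: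
  fixes \<beta> :: "complex^('n::finite + 'n)^'n"
  assumes 1: "\<beta> ** cadj \<beta> = mat 1" and 0: "\<beta> ** Jmat ** cadj \<beta> = 0"
  shows "cadj \<beta> ** \<beta> - Jmat ** cadj \<beta> ** \<beta> ** Jmat = mat 1"
proof -
  define \<gamma> where "\<gamma> = \<beta> ** Jmat"
  define U :: "complex^('n + 'n)^('n + 'n)" where
    "U = (\<chi> i. case i of Inl a \<Rightarrow> \<beta> $ a | Inr a \<Rightarrow> \<gamma> $ a)"
  have c\<gamma>: "cadj \<gamma> = - (Jmat ** cadj \<beta>)"
    by (simp add: \<gamma>_def cadj_mult cadj_Jmat matrix_mult_minus)
  have \<gamma>\<gamma>: "\<gamma> ** cadj \<gamma> = mat 1"
  proof -
    have "\<gamma> ** cadj \<gamma> = - (\<gamma> ** (Jmat ** cadj \<beta>))"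
      by (simp add: c\<gamma> matrix_mult_minus)
    also have "\<gamma> ** (Jmat ** cadj \<beta>) = \<beta> ** (Jmat ** Jmat) ** cadj \<beta>"
      by (simp only: \<gamma>_def matrix_mul_assoc)
    finally have "\<gamma> ** cadj \<gamma> = - (\<beta> ** (Jmat ** Jmat) ** cadj \<beta>)" .
    then show ?thesis by (simp add: Jmat_mult_Jmat matrix_mult_minus 1)
  qed
  have \<gamma>\<beta>: "\<gamma> ** cadj \<beta> = 0" using 0 by (simp add: \<gamma>_def)
  have \<beta>\<gamma>: "\<beta> ** cadj \<gamma> = 0"
    using arg_cong[OF \<gamma>\<beta>, of cadj] by (simp add: cadj_mult)
  have "U ** cadj U = mat 1"
  proof (subst vec_eq_iff, intro allI, subst vec_eq_iff, intro allI)
    fix i j :: "'n + 'n"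
    have e: "(A ** cadj B) $ a $ b = (\<Sum>k\<in>UNIV. A $ a $ k * cnj (B $ b $ k))"
      for A B :: "complex^('n+'n)^'n" and a b
      by (simp add: matrix_matrix_mult_def cadj_def)
    have "(U ** cadj U) $ i $ j = (\<Sum>k\<in>UNIV. U $ i $ k * cnj (U $ j $ k))"
      by (simp add: matrix_matrix_mult_def cadj_def)
    also have "\<dots> = mat 1 $ i $ j"
      using e[of \<beta> \<beta>] e[of \<beta> \<gamma>] e[of \<gamma> \<beta>] e[of \<gamma> \<gamma>]
      by (cases i; cases j) (simp_all add: U_def 1 \<gamma>\<gamma> \<gamma>\<beta> \<beta>\<gamma> mat_def flip: e)
    finally show "(U ** cadj U) $ i $ j = mat 1 $ i $ j" .
  qed
  then have "cadj U ** U = mat 1" using matrix_left_right_inverse by blast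
  moreover have "cadj U ** U = cadj \<beta> ** \<beta> + cadj \<gamma> ** \<gamma>"
    by (simp add: vec_eq_iff matrix_matrix_mult_def cadj_def U_def sum_UNIV_Plus)
  moreover have "cadj \<gamma> ** \<gamma> = - (Jmat ** cadj \<beta> ** \<beta> ** Jmat)"
    unfolding c\<gamma> by (simp add: \<gamma>_def matrix_mult_minus matrix_mul_assoc)
  ultimately show ?thesis by simp
qed

text \<open>What remains of the decomposition of the identity on the kernel of \<beta>. The explicit
  coordinate vector shows that this kernel lies in the range of \<open>Jmat ** cadj \<beta>\<close>,
  an n-parameter family.\<close>

lemma lagrangian_kernel:
  fixes \<beta> :: "complex^('n::finite + 'n)^'n"
  assumes "\<beta> ** cadj \<beta> = mat 1" "\<beta> ** Jmat ** cadj \<beta> = 0" "\<beta> *v w = 0"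
  shows "w = Jmat *v (cadj \<beta> *v (- (\<beta> *v (Jmat *v w))))"
proof -
  have "w = (cadj \<beta> ** \<beta> - Jmat ** cadj \<beta> ** \<beta> ** Jmat) *v w"
    by (simp add: lagrangian_decomposition[OF assms(1,2)])
  also have "\<dots> = cadj \<beta> *v (\<beta> *v w) - Jmat *v (cadj \<beta> *v (\<beta> *v (Jmat *v w)))"
    by (simp add: matrix_vector_mult_diff_rdistrib matrix_vector_mul_assoc matrix_mul_assoc)
  finally show ?thesis using assms(3) by (simp add: matrix_vector_mult_minus)
qed

text \<open>For \<open>w\<close> in the kernel of \<beta>, \<open>Jmat *v w\<close> lies in the
  range of \<open>cadj \<beta>\<close>, which is orthogonal to that kernel.\<close>

lemma lagrangian_isotropic:
  fixes \<beta> :: "complex^('n::finite + 'n)^'n"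
  assumes "\<beta> ** cadj \<beta> = mat 1" "\<beta> ** Jmat ** cadj \<beta> = 0" "\<beta> *v w = 0"
  shows "cip w (Jmat *v w) = 0"
proof -
  define d where "d = - (\<beta> *v (Jmat *v w))"
  have w: "w = Jmat *v (cadj \<beta> *v d)" unfolding d_def by (rule lagrangian_kernel[OF assms])
  have "Jmat *v w = - (cadj \<beta> *v d)" by (subst w) (rule Jmat_Jmat_vec)
  then have "cip w (Jmat *v w) = - cip (\<beta> *v w) d" by (simp add: cip_minus cip_matrix)
  then show ?thesis using assms(3) by (simp add: cip_def)
qed

section \<open>Canonical systems\<close>

lemma canon_eq_subset: "canon_eq H I f g \<Longrightarrow> K \<subseteq> I \<Longrightarrow> canon_eq H K f g"
  unfolding canon_eq_def by (auto elim!: eventually_mono)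

lemma loc_abs_cont_onD: "loc_abs_cont_on S f \<Longrightarrow> {a..b} \<subseteq> S \<Longrightarrow> abs_cont_on {a..b} f"
  by (simp add: loc_abs_cont_on_def)

lemma Jmat_solve: "Jmat *v d = v \<longleftrightarrow> d = - (Jmat *v v)"
proof
  assume "Jmat *v d = v"
  then have "Jmat *v (Jmat *v d) = Jmat *v v" by simp
  then show "d = - (Jmat *v v)" by (metis Jmat_Jmat_vec minus_minus)
qed (simp add: matrix_vector_mult_minus Jmat_Jmat_vec)

lemma Jmat_cadj: "cadj Jmat *v v = - (Jmat *v v)"
  by (simp add: cadj_Jmat matrix_vector_mult_minus)

lemma has_vector_derivative_matrix_vector:
  fixes f :: "real \<Rightarrow> complex^'m::finite" and M :: "complex^'m^'k::finite"
  assumes "(f has_vector_derivative f') (at x)"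
  shows "((\<lambda>x. M *v f x) has_vector_derivative M *v f') (at x)"
  using bounded_bilinear.has_vector_derivative[OF bounded_bilinear_matrix_vector_mult
      has_vector_derivative_const[of M] assms] by simp

lemma has_vector_derivative_vector_const:
  fixes Y :: "real \<Rightarrow> complex^'m::finite^'k::finite"
  assumes "(Y has_vector_derivative Y') (at x)"
  shows "((\<lambda>x. Y x *v c) has_vector_derivative Y' *v c) (at x)"
  using bounded_bilinear.has_vector_derivative[OF bounded_bilinear_matrix_vector_mult
      assms has_vector_derivative_const[of c]] by simp

lemma abs_cont_on_matrix_vector:
  fixes f :: "real \<Rightarrow> complex^'m::finite" and M :: "complex^'m^'k::finite"
  assumes "abs_cont_on S f" shows "abs_cont_on S (\<lambda>x. M *v f x)"
  by (rule abs_cont_on_linear[OF bounded_bilinear.bounded_linear_right[OF bounded_bilinear_matrix_vector_mult] assms])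

lemma abs_cont_on_vector_const:
  fixes Y :: "real \<Rightarrow> complex^'m::finite^'k::finite"
  assumes "abs_cont_on S Y" shows "abs_cont_on S (\<lambda>x. Y x *v c)"
  by (rule abs_cont_on_linear[OF bounded_bilinear.bounded_linear_left[OF bounded_bilinear_matrix_vector_mult] assms])

text \<open>\<^const>\<open>is_msol\<close> fixes the number of columns to \<open>n\<close>; the fundamental matrix needs \<open>2n\<close>.\<close>

definition msol :: "(real \<Rightarrow> complex^('n::finite + 'n)^('n + 'n)) \<Rightarrow> complex
    \<Rightarrow> (real \<Rightarrow> complex^'p::finite^('n + 'n)) \<Rightarrow> bool" where
  "msol H z u \<longleftrightarrow> loc_abs_cont_on {0..} u \<and>
     (AE x in lebesgue. 0 < x \<longrightarrow>
        (\<exists>d. (u has_vector_derivative d) (at x) \<and> Jmat ** d = - cscale z (H x ** u x)))"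

lemma is_msol_iff_msol: "is_msol H z u0 u \<longleftrightarrow> msol H z u \<and> u 0 = u0"
  unfolding is_msol_def msol_def cscale_def by (simp add: conj_ac)

text \<open>Regularity of the endpoint is stored in \<open>H_int\<close>: the intervals reach down
  to 0, which gives meaning to initial values there.\<close>

locale canonical_system =
  fixes H :: "real \<Rightarrow> complex^('n::finite + 'n)^('n + 'n)"
  assumes H_int: "\<And>b. H absolutely_integrable_on {0..b}"
    and H_psd: "AE x in lebesgue. 0 < x \<longrightarrow> psd (H x)"
begin

section \<open>The fundamental matrix: existence, inverse, and uniqueness of solutions\<close>

lemma msol_exists: "\<exists>Y. msol H z Y \<and> Y 0 = mat 1"
proof -
  have int: "(\<lambda>x. cscale z (Jmat ** H x)) absolutely_integrable_on {0..b}" for b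
    using absolutely_integrable_linear[OF H_int[of b] bounded_linear_compose[OF bounded_linear_cscale
          bounded_bilinear.bounded_linear_right[OF bounded_bilinear_matrix_mult], of z Jmat]]
    by (simp add: o_def)
  obtain Y where Y: "Y 0 = mat 1" "loc_abs_cont_on {0..} Y"
    "AE x in lebesgue. 0 < x \<longrightarrow> (Y has_vector_derivative cscale z (Jmat ** H x) ** Y x) (at x)"
    by (rule linear_ode_existence[OF bounded_bilinear_matrix_mult int, where ?y0.0 = "mat 1"])
  have "Jmat ** (cscale z (Jmat ** H x) ** Y x) = - cscale z (H x ** Y x)" for x
    by (simp add: cscale_matrix_mult matrix_mul_assoc Jmat_mult_Jmat matrix_mult_minus cscale_minus)
  then have "msol H z Y"
    unfolding msol_def using Y by (auto elim!: eventually_mono)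
  with Y(1) show ?thesis by blast
qed

text \<open>The choice is harmless on the closed half line, where \<open>msol_eq_fund\<close> shows
  that a solution is determined by its value at 0.\<close>

definition fund :: "complex \<Rightarrow> real \<Rightarrow> complex^('n + 'n)^('n + 'n)" where
  "fund z = (SOME Y. msol H z Y \<and> Y 0 = mat 1)"

lemma msol_fund: "msol H z (fund z)" and fund_0 [simp]: "fund z 0 = mat 1"
  unfolding atomize_conj fund_def using msol_exists by (rule someI_ex)

lemma fund_ac: "0 \<le> a \<Longrightarrow> abs_cont_on {a..b} (fund z)"
  using msol_fund[of z] by (auto simp: msol_def intro: loc_abs_cont_onD)

lemma fund_ode: "AE x in lebesgue. 0 < x \<longrightarrow>
        (\<exists>d. (fund z has_vector_derivative d) (at x) \<and> Jmat ** d = - cscale z (H x ** fund z x))"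
  using msol_fund[of z] by (simp add: msol_def)

lemma canon_eq_msol:
  assumes "msol H z u"
  shows "canon_eq H {0<..} (\<lambda>x. u x *v c) (\<lambda>x. z *s (u x *v c))"
  unfolding canon_eq_def
  using assms[unfolded msol_def, THEN conjunct2]
proof eventually_elim
  case (elim x)
  show ?case
  proof
    assume "x \<in> {0<..}"
    then obtain d where d: "(u has_vector_derivative d) (at x)" "Jmat ** d = - cscale z (H x ** u x)"
      using elim by auto
    have "Jmat *v (d *v c) = - cscale z (H x ** u x) *v c"
      by (simp add: matrix_vector_mul_assoc d)
    also have "\<dots> = - (H x *v (z *s (u x *v c)))"
      by (simp add: matrix_vector_mult_minus cscale_vector_mult matrix_vector_mult_smult matrix_vector_mul_assoc)
    finally show "\<exists>d. ((\<lambda>x. u x *v c) has_vector_derivative d) (at x) \<and> Jmat *v d = - (H x *v (z *s (u x *v c)))"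
      using has_vector_derivative_vector_const[OF d(1)] by blast
  qed
qed

lemma canon_eq_fund: "canon_eq H {0<..} (\<lambda>x. fund z x *v c) (\<lambda>x. z *s (fund z x *v c))"
  by (rule canon_eq_msol[OF msol_fund])

lemma H_hermitian: "AE x in lebesgue. 0 < x \<longrightarrow> cadj (H x) = H x"
  using H_psd
proof eventually_elim
  case (elim x)
  show ?case
  proof
    assume "0 < x"
    then have "psd (H x)" using elim by blast
    have "cadj (H x) *v v = H x *v v" for v
    proof -
      have "cip (cadj (H x) *v v - H x *v v) w = 0" for w
      proof -
        have "cip (cadj (H x) *v v - H x *v v) w = cip (cadj (H x) *v v) w - cip (H x *v v) w"
          using cip_add(1)[of "cadj (H x) *v v" "- (H x *v v)" w] by (simp add: cip_minus)
        also have "cip (cadj (H x) *v v) w = cip (H x *v v) w"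
          using psd_imp_hermitian[OF \<open>psd (H x)\<close>] by (simp flip: cip_matrix)
        finally show ?thesis by simp
      qed
      then show ?thesis using cip_self_eq_0 by (metis eq_iff_diff_eq_0)
    qed
    then show "cadj (H x) = H x" by (simp add: matrix_eq)
  qed
qed

text \<open>This identity replaces a Gronwall argument: it yields both the invertibility of the fundamental
  matrix and the uniqueness of solutions, also for solutions given only on the open half line.\<close>

lemma wronskian_const:
  assumes ab: "0 \<le> a" "a \<le> b" and f: "abs_cont_on {a..b} f"
    and ode: "canon_eq H {a<..<b} f (\<lambda>x. z *s f x)"
  shows "cadj (fund (cnj z) b) *v (Jmat *v f b) = cadj (fund (cnj z) a) *v (Jmat *v f a)"
proof (rule abs_cont_on_constant[OF ab(2)])
  show "abs_cont_on {a..b} (\<lambda>x. cadj (fund (cnj z) x) *v (Jmat *v f x))"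
    by (intro abs_cont_on_bilinear[OF bounded_bilinear_matrix_vector_mult]
        abs_cont_on_linear[OF bounded_linear_cadj] fund_ac ab abs_cont_on_matrix_vector f)
  show "AE x in lebesgue. x \<in> {a<..<b} \<longrightarrow>
      ((\<lambda>x. cadj (fund (cnj z) x) *v (Jmat *v f x)) has_vector_derivative 0) (at x)"
    using fund_ode[of "cnj z"] ode[unfolded canon_eq_def] H_hermitian
  proof eventually_elim
    case (elim x)
    show ?case
    proof
      assume x: "x \<in> {a<..<b}"
      then have x0: "0 < x" using ab by auto
      obtain D where D: "(fund (cnj z) has_vector_derivative D) (at x)"
        "Jmat ** D = - cscale (cnj z) (H x ** fund (cnj z) x)" using elim(1) x0 by blast
      obtain d where d: "(f has_vector_derivative d) (at x)" "Jmat *v d = - (H x *v (z *s f x))"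
        using elim(2) x by blast
      have herm: "cadj (H x) = H x" using elim(3) x0 by blast
      let ?Y = "cadj (fund (cnj z) x)"
      \<comment> \<open>Taking adjoints turns the parameter \<open>cnj z\<close> back into
        \<open>z\<close>, and H is Hermitian; so the two terms of the product rule will be opposite.
        This is why the conjugate parameter is paired with \<open>z\<close>.\<close>
      have "cadj D ** cadj Jmat = - cscale z (?Y ** H x)"
        using arg_cong[OF D(2), of cadj] by (simp add: cadj_mult herm)
      then have DJ: "cadj D ** Jmat = cscale z (?Y ** H x)"
        by (simp add: cadj_Jmat matrix_mult_minus)
      have "((\<lambda>x. cadj (fund (cnj z) x)) has_vector_derivative cadj D) (at x)"
        by (rule bounded_linear.has_vector_derivative[OF bounded_linear_cadj D(1)])
      from bounded_bilinear.has_vector_derivative[OF bounded_bilinear_matrix_vector_mult this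
          has_vector_derivative_matrix_vector[OF d(1), of Jmat]]
      have der: "((\<lambda>x. cadj (fund (cnj z) x) *v (Jmat *v f x)) has_vector_derivative
          ?Y *v (Jmat *v d) + cadj D *v (Jmat *v f x)) (at x)" .
      have "cadj D *v (Jmat *v f x) = z *s (?Y *v (H x *v f x))"
        by (simp add: matrix_vector_mul_assoc DJ cscale_vector_mult)
      moreover have "?Y *v (Jmat *v d) = - (z *s (?Y *v (H x *v f x)))"
        by (simp add: d(2) matrix_vector_mult_minus matrix_vector_mult_smult)
      ultimately show "((\<lambda>x. cadj (fund (cnj z) x) *v (Jmat *v f x)) has_vector_derivative 0) (at x)"
        using der by simp
    qed
  qed
qed

text \<open>Constancy of the Wronskian says that the adjoint of \<open>fund (cnj z) x\<close>, times
  J, times \<open>fund z x\<close>, equals J. The formula solves this for the inverse of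
  \<open>fund z x\<close>, the inverse of J being - J.\<close>

definition fund_inv :: "complex \<Rightarrow> real \<Rightarrow> complex^('n + 'n)^('n + 'n)" where
  "fund_inv z x = - (Jmat ** cadj (fund (cnj z) x) ** Jmat)"

lemma fund_inv:
  assumes "0 \<le> x"
  shows "fund_inv z x ** fund z x = mat 1" "fund z x ** fund_inv z x = mat 1"
proof -
  have "fund_inv z x *v (fund z x *v c) = c" for c
  proof -
    have "cadj (fund (cnj z) x) *v (Jmat *v (fund z x *v c)) = cadj (fund (cnj z) 0) *v (Jmat *v (fund z 0 *v c))"
    proof (rule wronskian_const[OF order_refl assms])
      show "abs_cont_on {0..x} (\<lambda>x. fund z x *v c)"
        by (rule abs_cont_on_vector_const[OF fund_ac[OF order_refl]])
      show "canon_eq H {0<..<x} (\<lambda>x. fund z x *v c) (\<lambda>x. z *s (fund z x *v c))"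
        by (rule canon_eq_subset[OF canon_eq_fund]) auto
    qed
    then have "Jmat *v (cadj (fund (cnj z) x) *v (Jmat *v (fund z x *v c))) = - c"
      by (simp add: Jmat_Jmat_vec)
    then show ?thesis
      by (simp add: fund_inv_def matrix_vector_mult_minus flip: matrix_vector_mul_assoc)
  qed
  then show "fund_inv z x ** fund z x = mat 1"
    by (simp add: matrix_eq flip: matrix_vector_mul_assoc)
  then show "fund z x ** fund_inv z x = mat 1"
    using matrix_left_right_inverse by blast
qed

lemma solution_eq_fund_from:
  assumes ab: "0 \<le> a" "a \<le> b" and f: "abs_cont_on {a..b} f"
    and ode: "canon_eq H {a<..<b} f (\<lambda>x. z *s f x)"
  shows "fund_inv z b *v f b = fund_inv z a *v f a"
  using wronskian_const[OF assms]
  by (simp add: fund_inv_def matrix_vector_mult_minus flip: matrix_vector_mul_assoc)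

lemma fund_vec_inv: "0 \<le> x \<Longrightarrow> fund z x *v (fund_inv z x *v v) = v"
  by (simp add: matrix_vector_mul_assoc fund_inv)

lemma solution_eq_fund_0:
  assumes f: "loc_abs_cont_on {0..} f" and ode: "canon_eq H {0<..} f (\<lambda>x. z *s f x)" and x: "0 \<le> x"
  shows "f x = fund z x *v f 0"
proof -
  have "fund_inv z x *v f x = fund_inv z 0 *v f 0"
    by (rule solution_eq_fund_from[OF _ x loc_abs_cont_onD[OF f] canon_eq_subset[OF ode]]) auto
  also have "\<dots> = f 0" using fund_vec_inv[of 0 z "f 0"] by simp
  finally show ?thesis using fund_vec_inv[OF x, of z "f x"] by simp
qed

text \<open>Solutions coming from \<open>Tmax\<close> are only given on the open half line, so no
  value at 0 is at hand. The vector \<open>c\<close> is read off at 1 instead; any interior point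
  would do, since \<open>fund_inv z x *v f x\<close> does not depend on \<open>x\<close>.\<close>

lemma solution_eq_fund:
  assumes f: "loc_abs_cont_on {0<..} f" and ode: "canon_eq H {0<..} f (\<lambda>x. z *s f x)"
  obtains c where "\<And>x. 0 < x \<Longrightarrow> f x = fund z x *v c"
proof
  fix x :: real assume x: "0 < x"
  have *: "fund_inv z b *v f b = fund_inv z a *v f a" if "0 < a" "a \<le> b" for a b
    by (rule solution_eq_fund_from[OF _ that(2) loc_abs_cont_onD[OF f] canon_eq_subset[OF ode]])
      (use that in auto)
  have "fund_inv z x *v f x = fund_inv z 1 *v f 1"
  proof (cases "x \<le> 1")
    case True show ?thesis by (rule *[OF x True, symmetric])
  next
    case False then show ?thesis by (intro *) auto
  qed
  then show "f x = fund z x *v (fund_inv z 1 *v f 1)"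
    using fund_vec_inv[of x z "f x"] x by simp
qed

text \<open>Reduces matrix solutions to vector solutions by applying them to constant vectors. It
  later makes the choice of \<open>u\<close> and \<open>v\<close> in both m functions
  immaterial.\<close>

lemma msol_eq_fund:
  assumes u: "msol H z u" and x: "0 \<le> x"
  shows "u x = fund z x ** u 0"
proof -
  have "u x *v c = (fund z x ** u 0) *v c" for c
  proof -
    have "loc_abs_cont_on {0..} (\<lambda>x. u x *v c)"
      unfolding loc_abs_cont_on_def
    proof (intro allI impI)
      fix a b assume "{a..b} \<subseteq> {0::real..}"
      with u have "abs_cont_on {a..b} u" by (simp add: msol_def loc_abs_cont_on_def)
      then show "abs_cont_on {a..b} (\<lambda>x. u x *v c)" by (rule abs_cont_on_vector_const)
    qed
    from solution_eq_fund_0[OF this canon_eq_msol[OF u] x]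
    show ?thesis by (simp add: matrix_vector_mul_assoc)
  qed
  then show ?thesis by (simp add: matrix_eq)
qed

lemma msol_fund_mult: "msol H z (\<lambda>x. fund z x ** u0)"
  unfolding msol_def
proof (intro conjI)
  show "loc_abs_cont_on {0..} (\<lambda>x. fund z x ** u0)"
    by (rule loc_abs_cont_on_atLeastI)
      (rule abs_cont_on_linear[OF bounded_bilinear.bounded_linear_left[OF bounded_bilinear_matrix_mult] fund_ac], simp)
  show "AE x in lebesgue. 0 < x \<longrightarrow> (\<exists>d. ((\<lambda>x. fund z x ** u0) has_vector_derivative d) (at x) \<and>
      Jmat ** d = - cscale z (H x ** (fund z x ** u0)))"
    using fund_ode[of z]
  proof eventually_elim
    case (elim x)
    show ?case
    proof
      assume "0 < x"
      then obtain D where D: "(fund z has_vector_derivative D) (at x)"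
        "Jmat ** D = - cscale z (H x ** fund z x)" using elim by blast
      have "((\<lambda>x. fund z x ** u0) has_vector_derivative D ** u0) (at x)"
        using bounded_bilinear.has_vector_derivative[OF bounded_bilinear_matrix_mult D(1)
            has_vector_derivative_const[of u0]] by (simp add: matrix_mult_minus)
      moreover have "Jmat ** (D ** u0) = - cscale z (H x ** (fund z x ** u0))"
        by (simp add: matrix_mul_assoc D(2) matrix_mult_minus cscale_matrix_mult)
      ultimately show "\<exists>d. ((\<lambda>x. fund z x ** u0) has_vector_derivative d) (at x) \<and>
          Jmat ** d = - cscale z (H x ** (fund z x ** u0))" by blast
    qed
  qed
qed

end

section \<open>A constant projection on the tail\<close>

lemma in_L2H_subset:
  assumes "in_L2H H I f" "K \<subseteq> I"
  shows "in_L2H H K f"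
  unfolding in_L2H_def
proof
  show "f \<in> borel_measurable (restrict_space lebesgue K)"
    using measurable_restrict_mono[OF _ assms(2)] assms(1) by (auto simp: in_L2H_def)
  have "(\<integral>\<^sup>+x\<in>K. ennreal (Re (hform (H x) (f x))) \<partial>lebesgue) \<le> (\<integral>\<^sup>+x\<in>I. ennreal (Re (hform (H x) (f x))) \<partial>lebesgue)"
    by (intro nn_integral_mono) (use assms(2) in \<open>auto simp: indicator_def\<close>)
  also have "\<dots> < \<infinity>" using assms(1) by (simp add: in_L2H_def)
  finally show "(\<integral>\<^sup>+x\<in>K. ennreal (Re (hform (H x) (f x))) \<partial>lebesgue) < \<infinity>" .
qed

lemma null_H_subset: "null_H H I f \<Longrightarrow> K \<subseteq> I \<Longrightarrow> null_H H K f"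
  unfolding null_H_def by (auto elim!: eventually_mono)

lemma continuous_on_hform: "continuous_on UNIV (\<lambda>x. hform (fst x) (snd x))"
  unfolding hform_eq_cip
  by (intro bounded_bilinear.continuous_on[OF bounded_bilinear_cip]
      bounded_bilinear.continuous_on[OF bounded_bilinear_matrix_vector_mult] continuous_intros)

lemma borel_measurable_hform:
  fixes M :: "'x \<Rightarrow> complex^'m::finite^'m"
  assumes "M \<in> borel_measurable N" "f \<in> borel_measurable N"
  shows "(\<lambda>x. hform (M x) (f x)) \<in> borel_measurable N"
  by (rule borel_measurable_continuous_Pair[OF assms continuous_on_hform])

lemma hform_bound:
  obtains K where "K > 0" "\<And>(M :: complex^'m::finite^'m) v. norm (hform M v) \<le> K * norm M * (norm v)\<^sup>2"
proof -
  obtain K1 where K1: "K1 > 0" "\<And>u v :: complex^'m. norm (cip u v) \<le> norm u * norm v * K1"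
    using bounded_bilinear.pos_bounded[OF bounded_bilinear_cip] by blast
  obtain K2 where K2: "K2 > 0" "\<And>(M :: complex^'m^'m) v. norm (M *v v) \<le> norm M * norm v * K2"
    using bounded_bilinear.pos_bounded[OF bounded_bilinear_matrix_vector_mult] by blast
  show thesis
  proof
    show "K1 * K2 > 0" using K1 K2 by simp
    fix M :: "complex^'m^'m" and v
    have "norm (hform M v) \<le> norm v * norm (M *v v) * K1" unfolding hform_eq_cip by (rule K1)
    also have "\<dots> \<le> norm v * (norm M * norm v * K2) * K1"
      using K1 K2 by (intro mult_right_mono mult_left_mono) auto
    also have "\<dots> = K1 * K2 * norm M * (norm v)\<^sup>2" by (simp add: power2_eq_square)
    finally show "norm (hform M v) \<le> K1 * K2 * norm M * (norm v)\<^sup>2" .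
  qed
qed

locale canonical_tail = canonical_system H
  for H :: "real \<Rightarrow> complex^('n::finite + 'n)^('n + 'n)" +
  fixes \<beta> :: "complex^('n + 'n)^'n" and L :: real
  assumes \<beta>_norm: "\<beta> ** cadj \<beta> = mat 1" and \<beta>_lagr: "\<beta> ** Jmat ** cadj \<beta> = 0"
    and L_pos: "0 < L" and H_tail: "\<And>x. x > L \<Longrightarrow> H x = cadj \<beta> ** \<beta>"
begin

text \<open>Integrability yields measurability on bounded intervals, and beyond L the matrix is
  constant. The indicator hides the values at negative arguments, about which nothing is
  assumed.\<close>

lemma H_measurable: "(\<lambda>x. indicator {0..} x *\<^sub>R H x) \<in> borel_measurable lebesgue"
proof -
  have 1: "(\<lambda>x. indicator {0..L} x *\<^sub>R H x) \<in> borel_measurable lebesgue"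
    using H_int[of L] unfolding set_integrable_def by (rule borel_measurable_integrable)
  have "(\<lambda>x. indicator {0..L} x *\<^sub>R H x + indicator {L<..} x *\<^sub>R (cadj \<beta> ** \<beta>)) \<in> borel_measurable lebesgue"
    by (intro borel_measurable_add 1 borel_measurable_scaleR borel_measurable_indicator) auto
  moreover have "indicator {0..} x *\<^sub>R H x = indicator {0..L} x *\<^sub>R H x + indicator {L<..} x *\<^sub>R (cadj \<beta> ** \<beta>)" for x
    using L_pos by (cases "x > L") (auto simp: indicator_def H_tail)
  ultimately show ?thesis by simp
qed

lemma hform_tail: "x > L \<Longrightarrow> hform (H x) v = of_real ((norm (\<beta> *v v))\<^sup>2)"
  by (simp only: H_tail hform_gram)

lemma H_tail_vec: "x > L \<Longrightarrow> H x *v v = cadj \<beta> *v (\<beta> *v v)"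
  by (simp add: H_tail matrix_vector_mul_assoc)

lemma hform_H_measurable:
  assumes f: "f \<in> borel_measurable (restrict_space lebesgue I)" and I: "I \<in> sets lebesgue" "I \<subseteq> {0..}"
  shows "(\<lambda>x. ennreal (Re (hform (H x) (f x))) * indicator I x) \<in> borel_measurable lebesgue"
proof -
  have f': "(\<lambda>x. indicator I x *\<^sub>R f x) \<in> borel_measurable lebesgue"
    using f I(1) by (simp add: borel_measurable_restrict_space_iff)
  have "(\<lambda>x. ennreal (Re (hform (indicator {0..} x *\<^sub>R H x) (indicator I x *\<^sub>R f x))) * indicator I x) \<in> borel_measurable lebesgue"
    using borel_measurable_hform[OF H_measurable f'] I(1) by measurable
  moreover have "ennreal (Re (hform (indicator {0..} x *\<^sub>R H x) (indicator I x *\<^sub>R f x))) * indicator I x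
      = ennreal (Re (hform (H x) (f x))) * indicator I x" for x
    using I(2) by (auto simp: indicator_def)
  ultimately show ?thesis by simp
qed

lemma in_L2H_Un:
  assumes 1: "in_L2H H {0<..<L} f" and 2: "in_L2H H {L<..} f"
  shows "in_L2H H {0<..} f"
  unfolding in_L2H_def
proof
  let ?h = "\<lambda>x. ennreal (Re (hform (H x) (f x)))"
  have m: "f \<in> borel_measurable (restrict_space lebesgue {0<..<L})"
    "f \<in> borel_measurable (restrict_space lebesgue {L<..})"
    using 1 2 by (auto simp: in_L2H_def)
  then have m1: "(\<lambda>x. indicator {0<..<L} x *\<^sub>R f x) \<in> borel_measurable lebesgue"
    and m2: "(\<lambda>x. indicator {L<..} x *\<^sub>R f x) \<in> borel_measurable lebesgue"
    by (simp_all add: borel_measurable_restrict_space_iff)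
  \<comment> \<open>The point L belongs to neither open piece. For measurability its value is added
    as a third summand; in the integral below it is a null set.\<close>
  have m3: "(\<lambda>x. indicator {L} x *\<^sub>R f L) \<in> borel_measurable lebesgue"
    by (intro borel_measurable_scaleR borel_measurable_indicator) auto
  have "(\<lambda>x. indicator {0<..<L} x *\<^sub>R f x + indicator {L<..} x *\<^sub>R f x + indicator {L} x *\<^sub>R f L) \<in> borel_measurable lebesgue"
    by (rule borel_measurable_add[OF borel_measurable_add[OF m1 m2] m3])
  moreover have "indicator {0<..} x *\<^sub>R f x = indicator {0<..<L} x *\<^sub>R f x + indicator {L<..} x *\<^sub>R f x + indicator {L} x *\<^sub>R f L" for x
    using L_pos by (auto simp: indicator_def)
  ultimately have "(\<lambda>x. indicator {0<..} x *\<^sub>R f x) \<in> borel_measurable lebesgue" by simp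
  then show "f \<in> borel_measurable (restrict_space lebesgue {0<..})"
    by (subst borel_measurable_restrict_space_iff) auto
  have "(\<integral>\<^sup>+x\<in>{0<..}. ?h x \<partial>lebesgue) = (\<integral>\<^sup>+x. ?h x * indicator {0<..<L} x + ?h x * indicator {L<..} x \<partial>lebesgue)"
  proof (rule nn_integral_cong_AE)
    have "AE x in lebesgue. x \<notin> {L}" by (rule AE_not_in) simp
    then show "AE x in lebesgue. ?h x * indicator {0<..} x = ?h x * indicator {0<..<L} x + ?h x * indicator {L<..} x"
      by eventually_elim (use L_pos in \<open>auto simp: indicator_def\<close>)
  qed
  also have "\<dots> = (\<integral>\<^sup>+x\<in>{0<..<L}. ?h x \<partial>lebesgue) + (\<integral>\<^sup>+x\<in>{L<..}. ?h x \<partial>lebesgue)"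
    by (intro nn_integral_add hform_H_measurable m) (use L_pos in auto)
  also have "\<dots> < \<infinity>" using 1 2 by (simp add: in_L2H_def)
  finally show "(\<integral>\<^sup>+x\<in>{0<..}. ?h x \<partial>lebesgue) < \<infinity>" .
qed

lemma beta_const:
  assumes b: "L \<le> b" and f: "abs_cont_on {L..b} f" and ode: "canon_eq H {L<..<b} f g"
  shows "\<beta> *v f b = \<beta> *v f L"
proof (rule abs_cont_on_constant[OF b abs_cont_on_matrix_vector[OF f]])
  show "AE x in lebesgue. x \<in> {L<..<b} \<longrightarrow> ((\<lambda>x. \<beta> *v f x) has_vector_derivative 0) (at x)"
    using ode[unfolded canon_eq_def]
  proof eventually_elim
    case (elim x)
    show ?case
    proof
      assume x: "x \<in> {L<..<b}"
      then obtain d where d: "(f has_vector_derivative d) (at x)" "Jmat *v d = - (H x *v g x)"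
        using elim by blast
      have "d = Jmat *v (cadj \<beta> *v (\<beta> *v g x))"
        using d(2) x by (simp add: Jmat_solve matrix_vector_mult_minus H_tail_vec)
      then have "\<beta> *v d = (\<beta> ** Jmat ** cadj \<beta>) *v (\<beta> *v g x)"
        by (simp only: matrix_vector_mul_assoc matrix_mul_assoc)
      then have "\<beta> *v d = 0" by (simp add: \<beta>_lagr)
      then show "((\<lambda>x. \<beta> *v f x) has_vector_derivative 0) (at x)"
        using has_vector_derivative_matrix_vector[OF d(1), of \<beta>] by simp
    qed
  qed
qed

lemma emeasure_tail: "emeasure lebesgue {L<..} = \<infinity>"
proof (rule ccontr)
  assume fin: "emeasure lebesgue {L<..} \<noteq> \<infinity>"
  obtain r where r: "0 \<le> r" "emeasure lebesgue {L<..} = ennreal r"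
    using fin by (cases "emeasure lebesgue {L<..}") auto
  have "emeasure lebesgue {L<..L + (r + 1)} \<le> emeasure lebesgue {L<..}"
    by (rule emeasure_mono) auto
  then show False using r by (simp add: ennreal_le_iff)
qed

lemma in_L2H_tail_const:
  assumes f: "in_L2H H {L<..} f" and w: "AE x in lebesgue. x > L \<longrightarrow> \<beta> *v f x = w"
  shows "w = 0"
proof (rule ccontr)
  assume "w \<noteq> 0"
  have "(\<integral>\<^sup>+x\<in>{L<..}. ennreal (Re (hform (H x) (f x))) \<partial>lebesgue) = (\<integral>\<^sup>+x. ennreal ((norm w)\<^sup>2) * indicator {L<..} x \<partial>lebesgue)"
  proof (rule nn_integral_cong_AE)
    show "AE x in lebesgue. ennreal (Re (hform (H x) (f x))) * indicator {L<..} x = ennreal ((norm w)\<^sup>2) * indicator {L<..} x"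
      using w by eventually_elim (auto simp: indicator_def hform_tail simp del: of_real_power)
  qed
  also have "\<dots> = ennreal ((norm w)\<^sup>2) * emeasure lebesgue {L<..}"
    by (rule nn_integral_cmult_indicator) simp
  also have "\<dots> = \<infinity>" using \<open>w \<noteq> 0\<close> by (simp add: emeasure_tail ennreal_mult_eq_top_iff)
  finally show False using f by (simp add: in_L2H_def)
qed

lemma null_H_tail: "null_H H {L<..} f \<longleftrightarrow> (AE x in lebesgue. x > L \<longrightarrow> \<beta> *v f x = 0)"
  unfolding null_H_def by (rule AE_cong) (auto simp: hform_tail simp del: of_real_power)

text \<open>Absolute continuity of \<open>f0\<close> is required only on intervals starting at L, so
  that the lemma applies both to \<open>S_half\<close>, with representatives on the closed half
  line, and to \<open>Tmax\<close>, with representatives on the open one.\<close>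

lemma tail_zero:
  assumes f: "in_L2H H {0<..} f" and f0: "\<And>b. abs_cont_on {L..b} f0"
    and null: "null_H H {0<..} (\<lambda>x. f x - f0 x)" and ode: "canon_eq H {0<..} f0 g"
  shows "\<beta> *v f0 L = 0" "null_H H {L<..} f"
proof -
  have c: "\<beta> *v f0 x = \<beta> *v f0 L" if "x > L" for x
    by (rule beta_const[OF less_imp_le[OF that] f0 canon_eq_subset[OF ode]]) (use L_pos in auto)
  have "null_H H {L<..} (\<lambda>x. f x - f0 x)" by (rule null_H_subset[OF null]) (use L_pos in auto)
  then have ae: "AE x in lebesgue. x > L \<longrightarrow> \<beta> *v f x = \<beta> *v f0 L"
    unfolding null_H_tail
    by eventually_elim (use c in \<open>auto simp: matrix_vector_mult_diff_distrib\<close>)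
  have "in_L2H H {L<..} f" by (rule in_L2H_subset[OF f]) (use L_pos in auto)
  from in_L2H_tail_const[OF this ae] show "\<beta> *v f0 L = 0" .
  with ae show "null_H H {L<..} f" by (simp add: null_H_tail)
qed

text \<open>On [0,L] the function is bounded and H is integrable, so the quadratic form is dominated
  by a multiple of the norm of H; beyond L the form is zero.\<close>

lemma in_L2H_continuous:
  assumes f: "continuous_on {0..} f" and tail: "\<And>x. x > L \<Longrightarrow> \<beta> *v f x = 0"
  shows "in_L2H H {0<..} f"
  unfolding in_L2H_def
proof
  have "continuous_on {0<..} f" by (rule continuous_on_subset[OF f]) auto
  then show "f \<in> borel_measurable (restrict_space lebesgue {0<..})"
    by (rule continuous_imp_measurable_on_sets_lebesgue) simp
  obtain K where K: "K > 0" "\<And>(M :: complex^('n + 'n)^('n + 'n)) v. norm (hform M v) \<le> K * norm M * (norm v)\<^sup>2"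
    using hform_bound by blast
  have "bounded (f ` {0..L})"
    by (intro compact_imp_bounded compact_continuous_image compact_Icc continuous_on_subset[OF f]) auto
  then obtain B where B: "\<And>x. x \<in> {0..L} \<Longrightarrow> norm (f x) \<le> B"
    unfolding bounded_iff ball_simps by metis
  have le: "ennreal (Re (hform (H x) (f x))) * indicator {0<..} x \<le> ennreal (K * B\<^sup>2) * ennreal (norm (indicator {0..L} x *\<^sub>R H x))" for x
  proof (cases "x \<in> {0<..L}")
    case True
    have "Re (hform (H x) (f x)) \<le> norm (hform (H x) (f x))" by (rule complex_Re_le_cmod)
    also have "\<dots> \<le> K * norm (H x) * (norm (f x))\<^sup>2" by (rule K)
    also have "\<dots> \<le> K * norm (H x) * B\<^sup>2"
      using K True by (intro mult_left_mono power_mono B) auto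
    finally have "ennreal (Re (hform (H x) (f x))) \<le> ennreal (K * B\<^sup>2 * norm (H x))"
      by (intro ennreal_leI) (simp add: mult_ac)
    then show ?thesis using True K by (simp add: ennreal_mult)
  next
    case False
    then show ?thesis using L_pos tail by (cases "x > L") (auto simp: hform_tail)
  qed
  have "integrable lebesgue (\<lambda>x. indicator {0..L} x *\<^sub>R H x)"
    using H_int[of L] by (simp add: set_integrable_def)
  then have m: "(\<lambda>x. indicator {0..L} x *\<^sub>R H x) \<in> borel_measurable lebesgue"
    and fin: "(\<integral>\<^sup>+x. ennreal (norm (indicator {0..L} x *\<^sub>R H x)) \<partial>lebesgue) < \<infinity>"
    by (auto simp: integrable_iff_bounded)
  have "(\<integral>\<^sup>+x\<in>{0<..}. ennreal (Re (hform (H x) (f x))) \<partial>lebesgue) \<le> (\<integral>\<^sup>+x. ennreal (K * B\<^sup>2) * ennreal (norm (indicator {0..L} x *\<^sub>R H x)) \<partial>lebesgue)"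
    by (intro nn_integral_mono le)
  also have "\<dots> = ennreal (K * B\<^sup>2) * (\<integral>\<^sup>+x. ennreal (norm (indicator {0..L} x *\<^sub>R H x)) \<partial>lebesgue)"
    by (rule nn_integral_cmult[OF measurable_compose[OF measurable_compose[OF m borel_measurable_norm] measurable_ennreal]])
  also have "\<dots> < \<infinity>" using fin by (simp add: ennreal_mult_less_top)
  finally show "(\<integral>\<^sup>+x\<in>{0<..}. ennreal (Re (hform (H x) (f x))) \<partial>lebesgue) < \<infinity>" .
qed

section \<open>Splitting the half-line relation at L\<close>

lemma S_half_imp_S_ab:
  assumes "(f, g) \<in> S_half H \<alpha>"
  shows "(f, g) \<in> S_ab H \<alpha> \<beta> L" "null_H H {L<..} f" "in_L2H H {L<..} f" "in_L2H H {L<..} g"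
proof -
  obtain f0 where f: "in_L2H H {0<..} f" and g: "in_L2H H {0<..} g"
    and f0: "loc_abs_cont_on {0..} f0" and null: "null_H H {0<..} (\<lambda>x. f x - f0 x)"
    and ode: "canon_eq H {0<..} f0 g" and bc: "\<alpha> *v f0 0 = 0"
    using assms unfolding S_half_def by blast
  have ac: "abs_cont_on {a..b} f0" if "0 \<le> a" for a b
    by (rule loc_abs_cont_onD[OF f0]) (use that in auto)
  have sub: "{0<..<L} \<subseteq> {0<..}" "{L<..} \<subseteq> {0<..}" using L_pos by auto
  note tz = tail_zero[OF f ac[OF less_imp_le[OF L_pos]] null ode]
  show "null_H H {L<..} f" by (rule tz(2))
  show "in_L2H H {L<..} f" "in_L2H H {L<..} g"
    using in_L2H_subset[OF f sub(2)] in_L2H_subset[OF g sub(2)] by auto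
  have "abs_cont_on {0..L} f0 \<and> null_H H {0<..<L} (\<lambda>x. f x - f0 x) \<and>
            canon_eq H {0<..<L} f0 g \<and> \<alpha> *v f0 0 = 0 \<and> \<beta> *v f0 L = 0"
    using ac[OF order_refl] null_H_subset[OF null sub(1)] canon_eq_subset[OF ode sub(1)] bc tz(1) by blast
  then show "(f, g) \<in> S_ab H \<alpha> \<beta> L"
    unfolding S_ab_def using in_L2H_subset[OF f sub(1)] in_L2H_subset[OF g sub(1)] by blast
qed

text \<open>Square integrability implies local integrability through
  \<open>r \<le> r\<^sup>2 + 1\<close>, with the square bounded by the quadratic form and 1
  integrated over a bounded interval. Thus \<beta> g has a primitive along which the representative
  can be continued.\<close>

lemma tail_integrable:
  assumes g: "in_L2H H {L<..} g"
  defines "q \<equiv> \<lambda>x. if L < x then \<beta> *v g x else 0"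
  shows "q absolutely_integrable_on {0..b}"
proof -
  have "(\<lambda>x. indicator {L<..} x *\<^sub>R g x) \<in> borel_measurable lebesgue"
    using g by (simp add: in_L2H_def borel_measurable_restrict_space_iff)
  then have "(\<lambda>x. \<beta> *v (indicator {L<..} x *\<^sub>R g x)) \<in> borel_measurable lebesgue"
  proof (rule measurable_compose)
    show "(\<lambda>v. \<beta> *v v) \<in> borel_measurable borel"
      by (intro borel_measurable_continuous_onI linear_continuous_on
          bounded_bilinear.bounded_linear_right[OF bounded_bilinear_matrix_vector_mult])
  qed
  moreover have "\<beta> *v (indicator {L<..} x *\<^sub>R g x) = q x" for x
    by (auto simp: q_def indicator_def)
  ultimately have qm: "q \<in> borel_measurable lebesgue" by simp
  have m: "(\<lambda>x. indicator {0..b} x *\<^sub>R q x) \<in> borel_measurable lebesgue"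
    by (intro borel_measurable_scaleR borel_measurable_indicator qm) auto
  have le: "ennreal (norm (indicator {0..b} x *\<^sub>R q x)) \<le> ennreal (Re (hform (H x) (g x))) * indicator {L<..} x + indicator {0..b} x" for x
  proof (cases "x \<in> {0..b} \<and> L < x")
    case True
    define r where "r = norm (\<beta> *v g x)"
    have "0 \<le> (r - 1)\<^sup>2" by simp
    moreover have "0 \<le> r" by (simp add: r_def)
    ultimately have "r \<le> r\<^sup>2 + 1" unfolding power2_diff by simp
    then have "ennreal r \<le> ennreal (r\<^sup>2 + 1)" by (rule ennreal_leI)
    also have "\<dots> = ennreal (r\<^sup>2) + 1" by (simp add: ennreal_plus)
    finally show ?thesis using True by (simp add: q_def r_def hform_tail del: of_real_power)
  qed (auto simp: q_def indicator_def)
  have "(\<integral>\<^sup>+x. ennreal (norm (indicator {0..b} x *\<^sub>R q x)) \<partial>lebesgue)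
      \<le> (\<integral>\<^sup>+x. ennreal (Re (hform (H x) (g x))) * indicator {L<..} x + indicator {0..b} x \<partial>lebesgue)"
    by (intro nn_integral_mono le)
  also have "\<dots> = (\<integral>\<^sup>+x\<in>{L<..}. ennreal (Re (hform (H x) (g x))) \<partial>lebesgue) + (\<integral>\<^sup>+x. indicator {0..b} x \<partial>lebesgue)"
    using g L_pos by (intro nn_integral_add hform_H_measurable borel_measurable_indicator) (auto simp: in_L2H_def)
  also have "\<dots> < \<infinity>"
    using g emeasure_lborel_cbox_finite[of 0 b] by (simp add: in_L2H_def)
  finally show ?thesis
    unfolding set_integrable_def integrable_iff_bounded using m by simp
qed

lemma S_ab_imp_S_half:
  assumes "(f, g) \<in> S_ab H \<alpha> \<beta> L" and fnull: "null_H H {L<..} f"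
    and fL: "in_L2H H {L<..} f" and gL: "in_L2H H {L<..} g"
  shows "(f, g) \<in> S_half H \<alpha>"
proof -
  obtain f0 where f: "in_L2H H {0<..<L} f" and g: "in_L2H H {0<..<L} g"
    and f0: "abs_cont_on {0..L} f0" and null: "null_H H {0<..<L} (\<lambda>x. f x - f0 x)"
    and ode: "canon_eq H {0<..<L} f0 g" and bc: "\<alpha> *v f0 0 = 0" "\<beta> *v f0 L = 0"
    using assms(1) unfolding S_ab_def by blast
  define q where "q = (\<lambda>x. if L < x then \<beta> *v g x else 0)"
  have q: "q absolutely_integrable_on {0..b}" for b
    unfolding q_def by (rule tail_integrable[OF gL])
  have q': "q integrable_on {0..b}" for b using q set_lebesgue_integral_eq_integral(1) by blast
  define p where "p = (\<lambda>x. integral {0..x} q)"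
  have p0: "p x = 0" if "x \<le> L" for x
  proof -
    have "p x = integral {0..x} (\<lambda>_. 0)"
      unfolding p_def by (rule Henstock_Kurzweil_Integration.integral_cong) (use that in \<open>auto simp: q_def\<close>)
    then show ?thesis by simp
  qed
  \<comment> \<open>A single formula on the whole half line: \<open>f0\<close> frozen at L plus a
    drift that is zero up to L. It is absolutely continuous as a sum, so no gluing of two pieces at
    L is required.\<close>
  define F where "F = (\<lambda>x. f0 (min x L) + (Jmat ** cadj \<beta>) *v p x)"
  have F_less: "F x = f0 x" if "x \<le> L" for x using that by (simp add: F_def p0 min_def)
  have F_tail: "\<beta> *v F x = 0" if "L < x" for x
  proof -
    have "\<beta> *v F x = \<beta> *v f0 L + (\<beta> ** Jmat ** cadj \<beta>) *v p x"
      using that by (simp add: F_def min_def matrix_vector_right_distrib matrix_vector_mul_assoc matrix_mul_assoc)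
    then show ?thesis by (simp add: bc \<beta>_lagr)
  qed
  have F_ac: "loc_abs_cont_on {0..} F"
    unfolding F_def p_def
    by (rule loc_abs_cont_on_atLeastI)
      (rule abs_cont_on_add[OF abs_cont_on_stopped[OF f0] abs_cont_on_matrix_vector[OF abs_cont_on_integral[OF q]]])
  have neL: "AE x in lebesgue. x \<noteq> L"
    using AE_not_in[of "{L}" lebesgue] by simp
  have F_null: "null_H H {0<..} (\<lambda>x. f x - F x)"
    unfolding null_H_def
    using null[unfolded null_H_def] fnull[unfolded null_H_tail] neL
  proof eventually_elim
    case (elim x)
    show ?case
    proof
      assume "x \<in> {0<..}"
      then consider "0 < x" "x < L" | "L < x" using elim(3) by fastforce
      then show "hform (H x) (f x - F x) = 0"
      proof cases
        case 1
        then show ?thesis using elim(1) by (simp add: F_less)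
      next
        case 2
        then have "\<beta> *v (f x - F x) = 0"
          using elim(2) F_tail by (simp add: matrix_vector_mult_diff_distrib)
        with 2 show ?thesis by (simp add: hform_tail)
      qed
    qed
  qed
  have F_ode: "canon_eq H {0<..} F g"
    unfolding canon_eq_def
    using ode[unfolded canon_eq_def] integral_has_vector_derivative_AE[OF q'] neL
  proof eventually_elim
    case (elim x)
    show ?case
    proof
      assume "x \<in> {0<..}"
      then consider "0 < x" "x < L" | "L < x" using elim(3) by fastforce
      then show "\<exists>d. (F has_vector_derivative d) (at x) \<and> Jmat *v d = - (H x *v g x)"
      proof cases
        case 1
        then obtain d where d: "(f0 has_vector_derivative d) (at x)" "Jmat *v d = - (H x *v g x)"
          using elim(1) by auto
        have "(F has_vector_derivative d) (at x)"
          by (rule has_vector_derivative_transform_within_open[OF d(1), of "{..<L}"])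
            (use 1 F_less in auto)
        with d(2) show ?thesis by blast
      next
        case 2
        then have "(p has_vector_derivative \<beta> *v g x) (at x)"
          using elim(2) L_pos by (simp add: p_def q_def)
        from has_vector_derivative_add[OF has_vector_derivative_const[of "f0 L"]
            has_vector_derivative_matrix_vector[OF this, of "Jmat ** cadj \<beta>"]]
        have "((\<lambda>x. f0 L + (Jmat ** cadj \<beta>) *v p x) has_vector_derivative
            (Jmat ** cadj \<beta>) *v (\<beta> *v g x)) (at x)" by simp
        then have "(F has_vector_derivative (Jmat ** cadj \<beta>) *v (\<beta> *v g x)) (at x)"
          by (rule has_vector_derivative_transform_within_open[of _ _ _ "{L<..}"])
            (use 2 in \<open>auto simp: F_def min_def\<close>)
        moreover have "Jmat *v ((Jmat ** cadj \<beta>) *v (\<beta> *v g x)) = - (H x *v g x)"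
          using 2 by (simp only: H_tail_vec Jmat_Jmat_vec flip: matrix_vector_mul_assoc)
        ultimately show ?thesis by blast
      qed
    qed
  qed
  have "\<alpha> *v F 0 = 0" using bc L_pos by (simp add: F_less)
  then have "\<exists>f0. loc_abs_cont_on {0..} f0 \<and> null_H H {0<..} (\<lambda>x. f x - f0 x) \<and>
            canon_eq H {0<..} f0 g \<and> \<alpha> *v f0 0 = 0"
    using F_ac F_null F_ode by blast
  then show ?thesis
    unfolding S_half_def using in_L2H_Un[OF f fL] in_L2H_Un[OF g gL] by blast
qed

lemma S_half_iff:
  "(f, g) \<in> S_half H \<alpha> \<longleftrightarrow>
    (f, g) \<in> S_ab H \<alpha> \<beta> L \<and> null_H H {L<..} f \<and> in_L2H H {L<..} f \<and> in_L2H H {L<..} g"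
  using S_half_imp_S_ab S_ab_imp_S_half by blast

end

section \<open>Closures of the domains and operator parts\<close>

lemma in_L2H_cong:
  assumes "\<And>x. x \<in> I \<Longrightarrow> f x = g x"
  shows "in_L2H H I f \<longleftrightarrow> in_L2H H I g"
proof -
  have "f \<in> borel_measurable (restrict_space lebesgue I) \<longleftrightarrow> g \<in> borel_measurable (restrict_space lebesgue I)"
    by (rule measurable_cong) (simp add: space_restrict_space assms)
  moreover have "(\<integral>\<^sup>+x\<in>I. ennreal (Re (hform (H x) (f x))) \<partial>lebesgue) = (\<integral>\<^sup>+x\<in>I. ennreal (Re (hform (H x) (g x))) \<partial>lebesgue)"
    by (rule nn_integral_cong) (auto simp: indicator_def assms)
  ultimately show ?thesis by (simp add: in_L2H_def)
qed

text \<open>Lets the values of a pair outside (0,L) be replaced before the pair is extended to the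
  half line.\<close>

lemma S_ab_cong:
  assumes p: "\<And>x. x \<in> {0<..<L} \<Longrightarrow> p x = p' x" and q: "\<And>x. x \<in> {0<..<L} \<Longrightarrow> q x = q' x"
    and "(p, q) \<in> S_ab H \<alpha> \<beta> L"
  shows "(p', q') \<in> S_ab H \<alpha> \<beta> L"
proof -
  obtain f0 where 1: "in_L2H H {0<..<L} p" "in_L2H H {0<..<L} q"
    and 2: "abs_cont_on {0..L} f0" "\<alpha> *v f0 0 = 0" "\<beta> *v f0 L = 0"
    and 3: "null_H H {0<..<L} (\<lambda>x. p x - f0 x)" "canon_eq H {0<..<L} f0 q"
    using assms(3) unfolding S_ab_def by blast
  have "in_L2H H {0<..<L} p'" "in_L2H H {0<..<L} q'"
    using 1 in_L2H_cong[of "{0<..<L}" p p' H] in_L2H_cong[of "{0<..<L}" q q' H] p q by blast+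
  moreover have "null_H H {0<..<L} (\<lambda>x. p' x - f0 x)"
    using 3(1) unfolding null_H_def by eventually_elim (use p in auto)
  moreover have "canon_eq H {0<..<L} f0 q'"
    using 3(2) unfolding canon_eq_def by eventually_elim (use q in auto)
  ultimately show ?thesis using 2 unfolding S_ab_def by blast
qed

context canonical_tail
begin

lemma normsq_H_mono: "K \<subseteq> I \<Longrightarrow> normsq_H H K h \<le> normsq_H H I h"
  unfolding normsq_H_def by (intro nn_integral_mono) (auto simp: indicator_def)

text \<open>Restriction to a smaller set does not increase \<open>normsq_H\<close>, and every domain
  element \<open>p\<close> is null beyond L; so the tail norm of \<open>h\<close> equals that of
  \<open>h - p\<close>, which is arbitrarily small. Conversely, approximants on (0,L) become domain
  elements on the half line once they are set to zero on the tail.\<close>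

lemma clos_dom_S_half:
  "h \<in> clos_dom H {0<..} (S_half H \<alpha>) \<longleftrightarrow>
    h \<in> clos_dom H {0<..<L} (S_ab H \<alpha> \<beta> L) \<and> null_H H {L<..} h \<and> in_L2H H {L<..} h"
proof
  assume "h \<in> clos_dom H {0<..} (S_half H \<alpha>)"
  then have h: "in_L2H H {0<..} h"
    and cl: "\<forall>\<epsilon>>0. \<exists>(p, q)\<in>S_half H \<alpha>. normsq_H H {0<..} (\<lambda>x. h x - p x) < ennreal \<epsilon>"
    by (auto simp: clos_dom_def)
  have sub: "{0<..<L} \<subseteq> {0<..}" "{L<..} \<subseteq> {0<..}" using L_pos by auto
  have hL: "in_L2H H {L<..} h" by (rule in_L2H_subset[OF h sub(2)])
  have "\<exists>(p, q)\<in>S_ab H \<alpha> \<beta> L. normsq_H H {0<..<L} (\<lambda>x. h x - p x) < ennreal \<epsilon>" if eps: "\<epsilon> > 0" for \<epsilon>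
  proof -
    obtain p q where pq: "(p, q) \<in> S_half H \<alpha>" "normsq_H H {0<..} (\<lambda>x. h x - p x) < ennreal \<epsilon>"
      using cl[rule_format, OF eps] by auto
    have "normsq_H H {0<..<L} (\<lambda>x. h x - p x) < ennreal \<epsilon>"
      using normsq_H_mono[OF sub(1)] pq(2) by (rule le_less_trans)
    with S_half_imp_S_ab(1)[OF pq(1)] show ?thesis by blast
  qed
  then have "h \<in> clos_dom H {0<..<L} (S_ab H \<alpha> \<beta> L)"
    using in_L2H_subset[OF h sub(1)] by (auto simp: clos_dom_def)
  moreover have "null_H H {L<..} h"
  proof -
    have small: "normsq_H H {L<..} h < ennreal \<epsilon>" if eps: "\<epsilon> > 0" for \<epsilon>
    proof -
      obtain p q where pq: "(p, q) \<in> S_half H \<alpha>" "normsq_H H {0<..} (\<lambda>x. h x - p x) < ennreal \<epsilon>"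
        using cl[rule_format, OF eps] by auto
      have "normsq_H H {L<..} h = normsq_H H {L<..} (\<lambda>x. h x - p x)"
        unfolding normsq_H_def
      proof (rule nn_integral_cong_AE)
        show "AE x in lebesgue. ennreal (Re (hform (H x) (h x))) * indicator {L<..} x =
            ennreal (Re (hform (H x) (h x - p x))) * indicator {L<..} x"
          using S_half_imp_S_ab(2)[OF pq(1), unfolded null_H_tail]
          by eventually_elim
            (auto simp: indicator_def hform_tail matrix_vector_mult_diff_distrib simp del: of_real_power)
      qed
      also have "\<dots> \<le> normsq_H H {0<..} (\<lambda>x. h x - p x)" by (rule normsq_H_mono[OF sub(2)])
      also have "\<dots> < ennreal \<epsilon>" by (rule pq(2))
      finally show ?thesis .
    qed
    have "normsq_H H {L<..} h = 0"
    proof (rule ccontr)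
      assume nz: "normsq_H H {L<..} h \<noteq> 0"
      obtain r where r: "0 \<le> r" "normsq_H H {L<..} h = ennreal r"
        using small[of 1] by (cases "normsq_H H {L<..} h") auto
      with nz have "r > 0" by (cases "r = 0") auto
      then show False using small[of r] r by simp
    qed
    then have "AE x in lebesgue. ennreal (Re (hform (H x) (h x))) * indicator {L<..} x = 0"
      unfolding normsq_H_def
      using hL L_pos by (subst (asm) nn_integral_0_iff_AE) (auto simp: in_L2H_def intro!: hform_H_measurable)
    then show ?thesis
      unfolding null_H_tail
      by eventually_elim (auto simp: indicator_def hform_tail simp del: of_real_power)
  qed
  ultimately show "h \<in> clos_dom H {0<..<L} (S_ab H \<alpha> \<beta> L) \<and> null_H H {L<..} h \<and> in_L2H H {L<..} h"
    using hL by blast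
next
  assume *: "h \<in> clos_dom H {0<..<L} (S_ab H \<alpha> \<beta> L) \<and> null_H H {L<..} h \<and> in_L2H H {L<..} h"
  then have h: "in_L2H H {0<..<L} h" and hL: "null_H H {L<..} h" "in_L2H H {L<..} h"
    and cl: "\<forall>\<epsilon>>0. \<exists>(p, q)\<in>S_ab H \<alpha> \<beta> L. normsq_H H {0<..<L} (\<lambda>x. h x - p x) < ennreal \<epsilon>"
    by (auto simp: clos_dom_def)
  have "\<exists>(p, q)\<in>S_half H \<alpha>. normsq_H H {0<..} (\<lambda>x. h x - p x) < ennreal \<epsilon>" if eps: "\<epsilon> > 0" for \<epsilon>
  proof -
    obtain p q where pq: "(p, q) \<in> S_ab H \<alpha> \<beta> L" "normsq_H H {0<..<L} (\<lambda>x. h x - p x) < ennreal \<epsilon>"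
      using cl[rule_format, OF eps] by auto
    \<comment> \<open>Membership in \<open>S_ab\<close> says nothing about the values beyond L.
      Cutting both functions off there makes \<open>p'\<close> null and both square integrable on
      the tail.\<close>
    define p' q' where "p' = (\<lambda>x. if x < L then p x else 0)" and "q' = (\<lambda>x. if x < L then q x else 0)"
    have z: "in_L2H H {L<..} (\<lambda>x. 0)"
      by (simp add: in_L2H_def hform_eq_cip cip_def)
    have "in_L2H H {L<..} p'" "in_L2H H {L<..} q'"
      using z in_L2H_cong[of "{L<..}" p' "\<lambda>x. 0"] in_L2H_cong[of "{L<..}" q' "\<lambda>x. 0"]
      by (auto simp: p'_def q'_def)
    moreover have "null_H H {L<..} p'" by (simp add: null_H_tail p'_def)
    moreover have "(p', q') \<in> S_ab H \<alpha> \<beta> L"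
      by (rule S_ab_cong[OF _ _ pq(1)]) (auto simp: p'_def q'_def)
    ultimately have "(p', q') \<in> S_half H \<alpha>" by (intro S_ab_imp_S_half)
    moreover have "normsq_H H {0<..} (\<lambda>x. h x - p' x) = normsq_H H {0<..<L} (\<lambda>x. h x - p x)"
      unfolding normsq_H_def
    proof (rule nn_integral_cong_AE)
      have "AE x in lebesgue. x \<noteq> L" using AE_not_in[of "{L}" lebesgue] by simp
      with hL(1)[unfolded null_H_tail]
      show "AE x in lebesgue. ennreal (Re (hform (H x) (h x - p' x))) * indicator {0<..} x =
          ennreal (Re (hform (H x) (h x - p x))) * indicator {0<..<L} x"
        by eventually_elim (use L_pos in \<open>auto simp: indicator_def hform_tail p'_def simp del: of_real_power\<close>)
    qed
    ultimately show ?thesis using pq(2) by (intro bexI[of _ "(p', q')"]) simp_all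
  qed
  then show "h \<in> clos_dom H {0<..} (S_half H \<alpha>)"
    using in_L2H_Un[OF h hL(2)] by (auto simp: clos_dom_def)
qed

text \<open>Membership of \<open>g\<close> in the closure of the domain forces it to be null beyond
  L; the tail then contributes only the zero class in both components.\<close>

lemma op_part_S_half:
  "(f, g) \<in> op_part H {0<..} (S_half H \<alpha>) \<longleftrightarrow>
    (f, g) \<in> op_part H {0<..<L} (S_ab H \<alpha> \<beta> L) \<and>
    null_H H {L<..} f \<and> in_L2H H {L<..} f \<and> null_H H {L<..} g \<and> in_L2H H {L<..} g"
proof -
  have "(f, g) \<in> op_part H {0<..} (S_half H \<alpha>) \<longleftrightarrow> (f, g) \<in> S_half H \<alpha> \<and>
      f \<in> clos_dom H {0<..} (S_half H \<alpha>) \<and> g \<in> clos_dom H {0<..} (S_half H \<alpha>)"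
    by (simp add: op_part_def)
  also have "\<dots> \<longleftrightarrow> (f, g) \<in> S_ab H \<alpha> \<beta> L \<and> f \<in> clos_dom H {0<..<L} (S_ab H \<alpha> \<beta> L) \<and>
      g \<in> clos_dom H {0<..<L} (S_ab H \<alpha> \<beta> L) \<and>
      null_H H {L<..} f \<and> in_L2H H {L<..} f \<and> null_H H {L<..} g \<and> in_L2H H {L<..} g"
    unfolding S_half_iff clos_dom_S_half by blast
  also have "\<dots> \<longleftrightarrow> (f, g) \<in> op_part H {0<..<L} (S_ab H \<alpha> \<beta> L) \<and>
    null_H H {L<..} f \<and> in_L2H H {L<..} f \<and> null_H H {L<..} g \<and> in_L2H H {L<..} g"
    by (simp add: op_part_def)
  finally show ?thesis .
qed

end

section \<open>Deficiency indices and the Titchmarsh-Weyl function\<close>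

lemma column_matrix_mult: "column k (A ** B) = A *v column k B"
  by (simp add: vec_eq_iff column_def matrix_matrix_mult_def matrix_vector_mult_def)

lemma matrix_eq_0_columns: "A = 0 \<longleftrightarrow> (\<forall>k. column k A = 0)"
  by (auto simp: vec_eq_iff column_def)

text \<open>Passes from the gauge integral delivered by the fundamental theorem to a Lebesgue
  integral, where a nonnegative integrand with integral zero vanishes almost everywhere. Replacing
  \<open>f\<close> by \<open>max 0 (f x)\<close> makes the sign valid at every point.\<close>

lemma AE_has_integral_0_nonneg:
  fixes f :: "real \<Rightarrow> real"
  assumes f: "(f has_integral 0) S" and S: "S \<in> sets lebesgue"
    and nn: "AE x in lebesgue. x \<in> S \<longrightarrow> 0 \<le> f x"
  shows "AE x in lebesgue. x \<in> S \<longrightarrow> f x = 0"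
proof -
  define k where "k = (\<lambda>x. max 0 (f x))"
  obtain N where N: "N \<in> null_sets lebesgue" "{x. \<not> (x \<in> S \<longrightarrow> 0 \<le> f x)} \<subseteq> N"
    using nn by (auto simp: eventually_ae_filter)
  have k: "(k has_integral 0) S"
  proof (rule has_integral_spike[OF _ _ f])
    show "negligible N" using N(1) by (simp add: negligible_iff_null_sets)
    show "k x = f x" if "x \<in> S - N" for x using that N(2) by (auto simp: k_def)
  qed
  have k0: "0 \<le> k x" for x by (simp add: k_def)
  have "k absolutely_integrable_on S"
    using k k0 by (intro nonnegative_absolutely_integrable_1) auto
  then have m: "(\<lambda>x. indicator S x *\<^sub>R k x) \<in> borel_measurable lebesgue"
    unfolding set_integrable_def by (rule borel_measurable_integrable)
  have "(\<integral>\<^sup>+x. ennreal (indicator S x * k x) \<partial>lebesgue) = 0"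
    using nn_integral_has_integral_lebesgue[OF k0 k] by (simp add: nn_integral_completion)
  moreover have "(\<lambda>x. ennreal (indicator S x * k x)) \<in> borel_measurable lebesgue"
    using measurable_compose[OF m measurable_ennreal] by simp
  ultimately have "AE x in lebesgue. ennreal (indicator S x * k x) = 0"
    by (simp only: nn_integral_0_iff_AE)
  with nn show ?thesis
    by eventually_elim (auto simp: k_def indicator_def ennreal_eq_0_iff)
qed

context canonical_tail
begin

definition definite :: bool where
  "definite \<longleftrightarrow> (\<forall>v. (AE x in lebesgue. x \<in> {0<..<L} \<longrightarrow> H x *v v = 0) \<longrightarrow> v = 0)"

lemma fund_vec_ac: "0 \<le> a \<Longrightarrow> abs_cont_on {a..b} (\<lambda>x. fund z x *v c)"
  by (rule abs_cont_on_vector_const[OF fund_ac])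

text \<open>Definiteness speaks about constant vectors. A solution annihilated by H has derivative
  zero almost everywhere, hence is constant on [0,L] and equal to its initial value
  \<open>c\<close>.\<close>

lemma definite_null_solution:
  assumes "definite" and null: "AE x in lebesgue. x \<in> {0<..<L} \<longrightarrow> H x *v (fund z x *v c) = 0"
  shows "c = 0"
proof -
  have const: "fund z b *v c = c" if b: "0 \<le> b" "b \<le> L" for b
  proof -
    have "fund z b *v c = fund z 0 *v c"
    proof (rule abs_cont_on_constant[OF b(1) fund_vec_ac[OF order_refl]])
      show "AE x in lebesgue. x \<in> {0<..<b} \<longrightarrow> ((\<lambda>x. fund z x *v c) has_vector_derivative 0) (at x)"
        using canon_eq_fund[of z c, unfolded canon_eq_def] null
      proof eventually_elim
        case (elim x)
        show ?case
        proof
          assume x: "x \<in> {0<..<b}"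
          then obtain d where d: "((\<lambda>x. fund z x *v c) has_vector_derivative d) (at x)"
            "Jmat *v d = - (H x *v (z *s (fund z x *v c)))" using elim(1) by auto
          have "H x *v (fund z x *v c) = 0" using elim(2) x b by auto
          then have "Jmat *v d = 0" using d(2) by (simp add: matrix_vector_mult_smult)
          then have "d = 0" by (simp add: Jmat_solve)
          then show "((\<lambda>x. fund z x *v c) has_vector_derivative 0) (at x)" using d(1) by simp
        qed
      qed
    qed
    then show ?thesis by simp
  qed
  have "AE x in lebesgue. x \<in> {0<..<L} \<longrightarrow> H x *v c = 0"
    using null
  proof eventually_elim
    case (elim x)
    show ?case
    proof
      assume x: "x \<in> {0<..<L}"
      then show "H x *v c = 0" using elim const[of x] by simp
    qed
  qed
  then show "c = 0" using assms(1) unfolding definite_def by blast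
qed

lemma fund_tail:
  assumes c: "\<beta> *v (fund z L *v c) = 0" and x: "L \<le> x"
  shows "\<beta> *v (fund z x *v c) = 0"
proof -
  have "\<beta> *v (fund z x *v c) = \<beta> *v (fund z L *v c)"
  proof (rule beta_const[OF x fund_vec_ac])
    show "canon_eq H {L<..<x} (\<lambda>x. fund z x *v c) (\<lambda>x. z *s (fund z x *v c))"
      by (rule canon_eq_subset[OF canon_eq_fund]) (use L_pos in auto)
  qed (use L_pos in simp)
  with c show ?thesis by simp
qed

lemma continuous_on_fund_vec: "continuous_on {0..} (\<lambda>x. fund z x *v c)"
  unfolding continuous_on_eq_continuous_within
proof
  fix x :: real assume x: "x \<in> {0..}"
  have "continuous_on {0..x + 1} (\<lambda>x. fund z x *v c)"
    by (rule abs_cont_on_imp_continuous_on[OF fund_vec_ac[OF order_refl]])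
  then have "continuous (at x within {0..x + 1}) (\<lambda>x. fund z x *v c)"
    using x by (simp add: continuous_on_eq_continuous_within)
  moreover have "at x within {0..x + 1} = at x within {0..}"
    by (rule at_within_nhd[of _ "{..<x + 1}"]) auto
  ultimately show "continuous (at x within {0..}) (\<lambda>x. fund z x *v c)" by simp
qed

lemma null_H_self: "null_H H I (\<lambda>x. f x - f x)"
  by (simp add: null_H_def hform_eq_cip cip_def)

lemma in_L2H_fund_iff: "in_L2H H {0<..} (\<lambda>x. fund z x *v c) \<longleftrightarrow> \<beta> *v (fund z L *v c) = 0"
proof
  assume f: "in_L2H H {0<..} (\<lambda>x. fund z x *v c)"
  show "\<beta> *v (fund z L *v c) = 0"
    using tail_zero(1)[OF f fund_vec_ac null_H_self canon_eq_fund] L_pos by simp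
next
  assume c: "\<beta> *v (fund z L *v c) = 0"
  show "in_L2H H {0<..} (\<lambda>x. fund z x *v c)"
    by (rule in_L2H_continuous[OF continuous_on_fund_vec fund_tail[OF c]]) simp
qed

lemma fund_in_Tmax:
  assumes c: "\<beta> *v (fund z L *v c) = 0"
  shows "((\<lambda>x. fund z x *v c), (\<lambda>x. z *s (fund z x *v c))) \<in> Tmax H"
proof -
  have eq: "z *s (fund z x *v c) = fund z x *v (z *s c)" for x
    by (simp add: matrix_vector_mult_smult)
  have "in_L2H H {0<..} (\<lambda>x. z *s (fund z x *v c))"
    unfolding eq in_L2H_fund_iff by (simp add: matrix_vector_mult_smult c)
  moreover have "loc_abs_cont_on {0<..} (\<lambda>x. fund z x *v c)"
    unfolding loc_abs_cont_on_def
  proof (intro allI impI)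
    fix a b :: real assume ab: "{a..b} \<subseteq> {0<..}"
    show "abs_cont_on {a..b} (\<lambda>x. fund z x *v c)"
      by (rule abs_cont_on_subset[OF fund_vec_ac[OF order_refl, of b]]) (use ab in auto)
  qed
  moreover have "in_L2H H {0<..} (\<lambda>x. fund z x *v c)" using c by (simp add: in_L2H_fund_iff)
  moreover note null_H_self[of "{0<..}" "\<lambda>x. fund z x *v c"] canon_eq_fund[of z c]
  ultimately show ?thesis
    unfolding Tmax_def by blast
qed

text \<open>In \<open>Tmax\<close> the right-hand side contains \<open>f\<close>, not its
  representative \<open>f0\<close>. Their difference has zero quadratic form, so positivity gives
  equal images under H, and \<open>f0\<close> solves the homogeneous equation itself.\<close>

lemma Tmax_eigen:
  assumes "(f, (\<lambda>x. z *s f x)) \<in> Tmax H"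
  obtains c where "\<beta> *v (fund z L *v c) = 0" "null_H H {0<..} (\<lambda>x. f x - fund z x *v c)"
proof -
  obtain f0 where f: "in_L2H H {0<..} f" and f0: "loc_abs_cont_on {0<..} f0"
    and null: "null_H H {0<..} (\<lambda>x. f x - f0 x)" and ode: "canon_eq H {0<..} f0 (\<lambda>x. z *s f x)"
    using assms unfolding Tmax_def by blast
  have "canon_eq H {0<..} f0 (\<lambda>x. z *s f0 x)"
    unfolding canon_eq_def using ode[unfolded canon_eq_def] null[unfolded null_H_def] H_psd
  proof eventually_elim
    case (elim x)
    show ?case
    proof
      assume x: "x \<in> {0<..}"
      have "H x *v (f x - f0 x) = 0"
        using psd_hform_eq_0[of "H x"] elim(2,3) x by simp
      then have "H x *v (z *s f x) = H x *v (z *s f0 x)"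
        by (simp add: matrix_vector_mult_smult matrix_vector_mult_diff_distrib)
      then show "\<exists>d. (f0 has_vector_derivative d) (at x) \<and> Jmat *v d = - (H x *v (z *s f0 x))"
        using elim(1) x by simp
    qed
  qed
  from solution_eq_fund[OF f0 this] obtain c where c: "\<And>x. 0 < x \<Longrightarrow> f0 x = fund z x *v c" by blast
  have ac: "abs_cont_on {L..b} f0" for b
    by (rule loc_abs_cont_onD[OF f0]) (use L_pos in auto)
  show thesis
  proof
    show "\<beta> *v (fund z L *v c) = 0"
      using tail_zero(1)[OF f ac null ode] c[OF L_pos] by simp
    show "null_H H {0<..} (\<lambda>x. f x - fund z x *v c)"
      using null unfolding null_H_def by eventually_elim (use c in auto)
  qed
qed

text \<open>The admissible initial values form the preimage of the kernel of \<beta> under the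
  invertible matrix \<open>fund z L\<close>, a space of dimension n whatever \<open>z\<close> is.
  Definiteness keeps the dimension when null functions are divided out.\<close>

lemma def_index_eq:
  assumes "definite"
  shows "def_index H z CARD('n)"
proof -
  obtain e :: "nat \<Rightarrow> 'n" where e: "bij_betw e {0..<CARD('n)} UNIV"
    using ex_bij_betw_nat_finite[of "UNIV :: 'n set"] by auto
  then have e': "bij_betw e {..<CARD('n)} UNIV" by (simp add: atLeast0LessThan)
  \<comment> \<open>The columns of \<open>W\<close> are the initial values whose solutions take the
    columns of \<open>Jmat ** cadj \<beta>\<close>, a basis of the kernel of \<beta>, as values at
    L.\<close>
  define W where "W = fund_inv z L ** (Jmat ** cadj \<beta>)"
  define fs where "fs = (\<lambda>i x. fund z x *v column (e i) W)"
  have fund_W: "fund z L ** W = Jmat ** cadj \<beta>"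
    using fund_inv(2)[of L z] L_pos by (simp add: W_def matrix_mul_assoc)
  have \<beta>W: "\<beta> *v (fund z L *v column k W) = 0" for k
  proof -
    have "\<beta> *v (fund z L *v column k W) = column k (\<beta> ** (fund z L ** W))"
      by (simp only: column_matrix_mult)
    also have "\<beta> ** (fund z L ** W) = 0"
      by (simp add: fund_W \<beta>_lagr matrix_mul_assoc)
    finally show ?thesis by (simp add: column_def vec_eq_iff)
  qed
  have comb: "(\<Sum>i<CARD('n). v $ e i *s fs i x) = fund z x *v (W *v v)" for v x
  proof -
    have "fund z x *v (W *v v) = (fund z x ** W) *v v" by (simp add: matrix_vector_mul_assoc)
    also have "\<dots> = (\<Sum>j\<in>UNIV. v $ j *s column j (fund z x ** W))" by (rule matrix_mult_sum)
    also have "\<dots> = (\<Sum>i<CARD('n). v $ e i *s column (e i) (fund z x ** W))"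
      by (rule sum.reindex_bij_betw[OF e', symmetric])
    also have "\<dots> = (\<Sum>i<CARD('n). v $ e i *s fs i x)"
      by (simp add: fs_def column_matrix_mult)
    finally show ?thesis by simp
  qed
  have lin: "v = 0" if "null_H H {0<..} (\<lambda>x. fund z x *v (W *v v))" for v
  proof -
    have "AE x in lebesgue. x \<in> {0<..<L} \<longrightarrow> H x *v (fund z x *v (W *v v)) = 0"
      using that[unfolded null_H_def] H_psd by eventually_elim (auto simp: psd_hform_eq_0)
    then have "W *v v = 0" by (rule definite_null_solution[OF assms])
    then have "(fund z L ** W) *v v = 0" by (simp flip: matrix_vector_mul_assoc)
    then have "Jmat *v (cadj \<beta> *v v) = 0" by (simp add: fund_W matrix_vector_mul_assoc)
    then have "cadj \<beta> *v v = 0" by (simp add: Jmat_solve)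
    then have "(\<beta> ** cadj \<beta>) *v v = 0" by (simp flip: matrix_vector_mul_assoc)
    then show "v = 0" by (simp add: \<beta>_norm)
  qed
  show ?thesis
    unfolding def_index_def quot_dim_def
  proof (intro exI[of _ fs] conjI allI impI ballI)
    fix i show "fs i \<in> {f. (f, \<lambda>x. z *s f x) \<in> Tmax H}"
      using fund_in_Tmax[OF \<beta>W] by (simp add: fs_def)
  next
    fix c :: "nat \<Rightarrow> complex" and i
    assume null: "null_H H {0<..} (\<lambda>x. \<Sum>i<CARD('n). c i *s fs i x)" and i: "i < CARD('n)"
    \<comment> \<open>The coefficients in \<open>quot_dim\<close> are indexed by natural numbers;
      the inverse of the enumeration \<open>e\<close> turns them into a vector to which
      \<open>W\<close> can be applied.\<close>
    define v :: "complex^'n" where "v = (\<chi> j. c (the_inv_into {..<CARD('n)} e j))"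
    have ve: "v $ e i = c i" if "i < CARD('n)" for i
      using e' that by (simp add: v_def the_inv_into_f_f bij_betw_def)
    have "(\<Sum>i<CARD('n). c i *s fs i x) = (\<Sum>i<CARD('n). v $ e i *s fs i x)" for x
      by (rule sum.cong) (auto simp: ve)
    then have "null_H H {0<..} (\<lambda>x. fund z x *v (W *v v))"
      using null by (simp add: comb)
    then have "v = 0" by (rule lin)
    then show "c i = 0" using ve[OF i] by simp
  next
    fix f assume "f \<in> {f. (f, \<lambda>x. z *s f x) \<in> Tmax H}"
    then obtain c where c: "\<beta> *v (fund z L *v c) = 0" "null_H H {0<..} (\<lambda>x. f x - fund z x *v c)"
      using Tmax_eigen[of f z] by blast
    define d where "d = - (\<beta> *v (Jmat *v (fund z L *v c)))"
    have "fund z L *v c = Jmat *v (cadj \<beta> *v d)"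
      unfolding d_def by (rule lagrangian_kernel[OF \<beta>_norm \<beta>_lagr c(1)])
    then have "fund_inv z L *v (fund z L *v c) = W *v d"
      by (simp add: W_def flip: matrix_vector_mul_assoc)
    then have "c = W *v d"
      using fund_inv(1)[of L z] L_pos by (simp add: matrix_vector_mul_assoc)
    then show "\<exists>c. null_H H {0<..} (\<lambda>x. f x - (\<Sum>i<CARD('n). c i *s fs i x))"
      using c(2) by (intro exI[of _ "\<lambda>i. d $ e i"]) (simp add: comb)
  qed
qed

text \<open>Green's identity makes \<open>f\<^sup>* H f\<close> integrate to zero: both boundary values lie in Lagrangian
  subspaces, on which the form \<open>w\<^sup>* J w\<close> vanishes.\<close>
lemma no_nonreal_eigenvalue:
  assumes "definite" and z: "Im z \<noteq> 0" and c: "cip c (Jmat *v c) = 0" and \<beta>c: "\<beta> *v (fund z L *v c) = 0"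
  shows "c = 0"
proof -
  let ?f = "\<lambda>x. fund z x *v c"
  have "AE x in lebesgue. x \<in> {0<..<L} \<longrightarrow>
      ((\<lambda>x. cip (?f x) (Jmat *v ?f x)) has_vector_derivative (cnj z - z) * hform (H x) (?f x)) (at x)"
    using canon_eq_fund[of z c, unfolded canon_eq_def] H_psd
  proof eventually_elim
    case (elim x)
    show ?case
    proof
      assume x: "x \<in> {0<..<L}"
      then obtain d where d: "(?f has_vector_derivative d) (at x)" "Jmat *v d = - (H x *v (z *s ?f x))"
        using elim(1) by auto
      have psd: "psd (H x)" using elim(2) x by simp
      from bounded_bilinear.has_vector_derivative[OF bounded_bilinear_cip d(1)
          has_vector_derivative_matrix_vector[OF d(1), of Jmat]]
      have der: "((\<lambda>x. cip (?f x) (Jmat *v ?f x)) has_vector_derivative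
          cip (?f x) (Jmat *v d) + cip d (Jmat *v ?f x)) (at x)" .
      have "cip d (Jmat *v ?f x) = cip (H x *v (z *s ?f x)) (?f x)"
        by (simp add: cip_matrix[of d] Jmat_cadj d(2))
      also have "\<dots> = cnj z * hform (H x) (?f x)"
        by (simp add: psd_imp_hermitian[OF psd, symmetric] hform_eq_cip cip_smult)
      moreover have "cip (?f x) (Jmat *v d) = - z * hform (H x) (?f x)"
        by (simp add: d(2) cip_minus matrix_vector_mult_smult cip_smult hform_eq_cip)
      ultimately show "((\<lambda>x. cip (?f x) (Jmat *v ?f x)) has_vector_derivative (cnj z - z) * hform (H x) (?f x)) (at x)"
        using der by (simp add: algebra_simps)
    qed
  qed
  then have "((\<lambda>x. (cnj z - z) * hform (H x) (?f x)) has_integral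
      (cip (?f L) (Jmat *v ?f L) - cip (?f 0) (Jmat *v ?f 0))) {0..L}"
    by (rule has_integral_abs_cont_on[OF less_imp_le[OF L_pos] abs_cont_on_bilinear[OF bounded_bilinear_cip
            fund_vec_ac[OF order_refl] abs_cont_on_matrix_vector[OF fund_vec_ac[OF order_refl]]]])
  then have "((\<lambda>x. (cnj z - z) * hform (H x) (?f x)) has_integral 0) {0..L}"
    by (simp add: c lagrangian_isotropic[OF \<beta>_norm \<beta>_lagr \<beta>c])
  \<comment> \<open>Here the nonreal parameter is used: \<open>cnj z - z\<close> is nonzero and can
    be divided out.\<close>
  from has_integral_mult_right[OF this, of "inverse (cnj z - z)"]
  have "((\<lambda>x. hform (H x) (?f x)) has_integral 0) {0..L}"
    using z by (simp add: complex_eq_iff flip: mult.assoc)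
  from has_integral_linear[OF this bounded_linear_Re]
  have "((\<lambda>x. Re (hform (H x) (?f x))) has_integral 0) {0..L}" by (simp add: o_def)
  moreover have ne0: "AE x in lebesgue. x \<noteq> (0::real)" using AE_not_in[of "{0::real}" lebesgue] by simp
  then have "AE x in lebesgue. x \<in> {0..L} \<longrightarrow> 0 \<le> Re (hform (H x) (?f x))"
    using H_psd by eventually_elim (auto simp: Re_hform_nonneg)
  ultimately have "AE x in lebesgue. x \<in> {0..L} \<longrightarrow> Re (hform (H x) (?f x)) = 0"
    by (intro AE_has_integral_0_nonneg) auto
  then have "AE x in lebesgue. x \<in> {0<..<L} \<longrightarrow> H x *v ?f x = 0"
    using H_psd
  proof eventually_elim
    case (elim x)
    then show ?case using psd_hform_eq_0[of "H x" "?f x"] by (auto simp: psd_def complex_eq_iff)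
  qed
  then show "c = 0" by (rule definite_null_solution[OF assms(1)])
qed

section \<open>Reduction of both m functions to one matrix equation, and its solvability\<close>

lemma m_fun_ab_iff:
  "m_fun_ab H \<alpha> \<beta> L z m \<longleftrightarrow> \<beta> ** (fund z L ** (cadj \<alpha> + - (Jmat ** cadj \<alpha>) ** m)) = 0"
proof -
  have eq: "v L + u L ** m = fund z L ** (cadj \<alpha> + - (Jmat ** cadj \<alpha>) ** m)"
    if "is_msol H z (- (Jmat ** cadj \<alpha>)) u" "is_msol H z (cadj \<alpha>) v" for u v
    using that L_pos msol_eq_fund[of z u L] msol_eq_fund[of z v L]
    by (simp add: is_msol_iff_msol matrix_add_ldistrib matrix_mul_assoc)
  have ex: "is_msol H z u0 (\<lambda>x. fund z x ** u0)" for u0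
    by (simp add: is_msol_iff_msol msol_fund_mult)
  show ?thesis
    unfolding m_fun_ab_def using eq ex by metis
qed

text \<open>Each column of \<open>v + u ** m\<close> is a vector solution, and its square
  integrability is the boundary condition \<beta> at L. Collecting the columns gives the equation
  that characterizes \<open>m_fun_ab\<close>.\<close>

lemma m_fun_S_iff:
  "m_fun_S H \<alpha> z m \<longleftrightarrow> \<beta> ** (fund z L ** (cadj \<alpha> + - (Jmat ** cadj \<alpha>) ** m)) = 0"
proof -
  let ?M = "cadj \<alpha> + - (Jmat ** cadj \<alpha>) ** m"
  have eq: "in_L2H H {0<..} (\<lambda>x. column k (v x + u x ** m)) \<longleftrightarrow> \<beta> *v (fund z L *v column k ?M) = 0"
    if "is_msol H z (- (Jmat ** cadj \<alpha>)) u" "is_msol H z (cadj \<alpha>) v" for u v k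
  proof -
    have "column k (v x + u x ** m) = fund z x *v column k ?M" if "x \<in> {0<..}" for x
    proof -
      have "v x + u x ** m = fund z x ** ?M"
        using \<open>is_msol H z _ u\<close> \<open>is_msol H z _ v\<close> that msol_eq_fund[of z u x] msol_eq_fund[of z v x]
        by (simp add: is_msol_iff_msol matrix_add_ldistrib matrix_mul_assoc)
      then show ?thesis by (simp add: column_matrix_mult)
    qed
    then have "in_L2H H {0<..} (\<lambda>x. column k (v x + u x ** m)) \<longleftrightarrow> in_L2H H {0<..} (\<lambda>x. fund z x *v column k ?M)"
      by (rule in_L2H_cong)
    then show ?thesis by (simp add: in_L2H_fund_iff)
  qed
  have ex: "is_msol H z u0 (\<lambda>x. fund z x ** u0)" for u0
    by (simp add: is_msol_iff_msol msol_fund_mult)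
  have "m_fun_S H \<alpha> z m \<longleftrightarrow> (\<forall>k. \<beta> *v (fund z L *v column k ?M) = 0)"
    unfolding m_fun_S_def using eq ex by blast
  then show ?thesis by (simp add: matrix_eq_0_columns column_matrix_mult)
qed

text \<open>The equation is \<open>V + U ** m = 0\<close> with \<open>U\<close> square, so it
  suffices that \<open>U\<close> is injective. If \<open>U *v e = 0\<close>, the solution starting
  at \<open>c\<close>, minus J applied to \<open>cadj \<alpha> *v e\<close>, satisfies both boundary
  conditions; it vanishes because there is no nonreal eigenvalue, and then so does
  \<open>e\<close>.\<close>

lemma m_fun_unique:
  fixes \<alpha> :: "complex^('n + 'n)^'n"
  assumes "definite" and z: "Im z \<noteq> 0"
    and \<alpha>_norm: "\<alpha> ** cadj \<alpha> = mat 1" and \<alpha>_lagr: "\<alpha> ** Jmat ** cadj \<alpha> = 0"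
  shows "\<exists>!m. \<beta> ** (fund z L ** (cadj \<alpha> + - (Jmat ** cadj \<alpha>) ** m)) = 0"
proof -
  define U where "U = \<beta> ** fund z L ** (- (Jmat ** cadj \<alpha>))"
  define V where "V = \<beta> ** fund z L ** cadj \<alpha>"
  have eq: "\<beta> ** (fund z L ** (cadj \<alpha> + - (Jmat ** cadj \<alpha>) ** m)) = V + U ** m" for m
    by (simp add: U_def V_def matrix_add_ldistrib matrix_mul_assoc)
  have "e = 0" if "U *v e = 0" for e
  proof -
    define c where "c = - (Jmat ** cadj \<alpha>) *v e"
    have c': "c = - (Jmat *v (cadj \<alpha> *v e))"
      by (simp add: c_def matrix_vector_mult_minus matrix_vector_mul_assoc)
    have "\<alpha> *v c = - ((\<alpha> ** Jmat ** cadj \<alpha>) *v e)"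
      by (simp only: c' matrix_vector_mult_minus matrix_vector_mul_assoc matrix_mul_assoc)
    then have "\<alpha> *v c = 0" by (simp add: \<alpha>_lagr)
    then have "cip c (Jmat *v c) = 0" by (rule lagrangian_isotropic[OF \<alpha>_norm \<alpha>_lagr])
    moreover have "\<beta> *v (fund z L *v c) = 0"
      using that by (simp add: U_def c_def matrix_vector_mul_assoc matrix_mul_assoc)
    ultimately have "c = 0" by (rule no_nonreal_eigenvalue[OF assms(1) z])
    then have "Jmat *v (cadj \<alpha> *v e) = 0" by (simp add: c')
    then have "cadj \<alpha> *v e = 0" by (simp add: Jmat_solve)
    then have "(\<alpha> ** cadj \<alpha>) *v e = 0" by (simp flip: matrix_vector_mul_assoc)
    then show "e = 0" by (simp add: \<alpha>_norm)
  qed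
  then obtain B where B: "B ** U = mat 1" using matrix_left_invertible_ker[of U] by blast
  then have B': "U ** B = mat 1" using matrix_left_right_inverse by blast
  show ?thesis
    unfolding eq
  proof (rule ex1I[of _ "- (B ** V)"])
    show "V + U ** - (B ** V) = 0"
      by (simp add: matrix_mult_minus matrix_mul_assoc B')
    fix m assume "V + U ** m = 0"
    then have "U ** m = - V" by (metis add_eq_0_iff)
    then have "B ** (U ** m) = - (B ** V)" by (simp add: matrix_mult_minus)
    then show "m = - (B ** V)" by (simp add: matrix_mul_assoc B)
  qed
qed

end

text \<open>Since relations consist of representatives, a direct sum is expressed by restriction:
  the pair belongs to the relation on (0,L), both functions are square integrable on the tail, and a
  zero component there means \<open>null_H\<close> on the tail.\<close>

theorem theorem6p1:
  fixes H :: "real \<Rightarrow> complex ^('n::finite+'n) ^('n+'n)"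
    and \<alpha> \<beta> :: "complex ^('n+'n) ^'n"
    and L :: real
  assumes loc_int: "\<And>a b. 0 < a \<Longrightarrow> set_integrable lebesgue {a..b} H"
    and psd: "AE x in lebesgue. x \<in> {0<..} \<longrightarrow> psd (H x)"
    and regular: "\<exists>c>0. set_integrable lebesgue {0<..<c} H"
    and \<alpha>_norm: "\<alpha> ** cadj \<alpha> = mat 1" and \<beta>_norm: "\<beta> ** cadj \<beta> = mat 1"
    and \<alpha>_lagr: "\<alpha> ** Jmat ** cadj \<alpha> = 0" and \<beta>_lagr: "\<beta> ** Jmat ** cadj \<beta> = 0"
    and L_pos: "L > 0"
    and H_tail: "\<And>x. x > L \<Longrightarrow> H x = cadj \<beta> ** \<beta>"
  shows "(\<forall>f g. (f, g) \<in> S_half H \<alpha> \<longleftrightarrow>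
            (f, g) \<in> S_ab H \<alpha> \<beta> L \<and> null_H H {L<..} f \<and> in_L2H H {L<..} f \<and> in_L2H H {L<..} g)
       \<and> ((\<forall>v. (AE x in lebesgue. x \<in> {0<..<L} \<longrightarrow> H x *v v = 0) \<longrightarrow> v = 0) \<longrightarrow>
            def_index H \<i> CARD('n) \<and> def_index H (- \<i>) CARD('n)
          \<and> (\<forall>f g. (f, g) \<in> op_part H {0<..} (S_half H \<alpha>) \<longleftrightarrow>
               (f, g) \<in> op_part H {0<..<L} (S_ab H \<alpha> \<beta> L) \<and>
               null_H H {L<..} f \<and> in_L2H H {L<..} f \<and> null_H H {L<..} g \<and> in_L2H H {L<..} g)
          \<and> (\<forall>z. Im z \<noteq> 0 \<longrightarrow> (\<exists>!m. m_fun_S H \<alpha> z m) \<and> (\<exists>!m. m_fun_ab H \<alpha> \<beta> L z m) \<and>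
               (\<forall>m. m_fun_S H \<alpha> z m \<longleftrightarrow> m_fun_ab H \<alpha> \<beta> L z m)))"
proof -
  obtain c where c: "c > 0" "set_integrable lebesgue {0<..<c} H" using regular by blast
  have "H absolutely_integrable_on {0..b}" for b
  proof -
    \<comment> \<open>Local integrability concerns intervals bounded away from 0, regularity a
      neighbourhood of 0. Starting the second interval at \<open>c / 2\<close> makes the two pieces
      cover (0,b]; the point 0 is negligible.\<close>
    have "H absolutely_integrable_on {0<..<c} \<union> {c / 2..b}"
      by (rule set_integrable_Un) (use c loc_int[of "c / 2" b] in auto)
    then have "H absolutely_integrable_on {0<..b}"
      by (rule set_integrable_subset) (use c in auto)
    then show ?thesis
    proof (rule absolutely_integrable_spike_set)
      show "negligible {x \<in> {0<..b} - {0..b}. H x \<noteq> 0}"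
        by (rule negligible_subset[of "{0::real}"]) auto
      show "negligible {x \<in> {0..b} - {0<..b}. H x \<noteq> 0}"
        by (rule negligible_subset[of "{0::real}"]) auto
    qed
  qed
  then interpret canonical_tail H \<beta> L
    by unfold_locales (use psd \<beta>_norm \<beta>_lagr L_pos H_tail in auto)
  show ?thesis
  proof (intro conjI impI allI)
    assume "\<forall>v. (AE x in lebesgue. x \<in> {0<..<L} \<longrightarrow> H x *v v = 0) \<longrightarrow> v = 0"
    then have def: definite unfolding definite_def .
    show "def_index H \<i> CARD('n)" "def_index H (- \<i>) CARD('n)"
      by (rule def_index_eq[OF def])+
    fix z assume "Im z \<noteq> 0"
    from m_fun_unique[OF def this \<alpha>_norm \<alpha>_lagr]
    show "\<exists>!m. m_fun_S H \<alpha> z m" "\<exists>!m. m_fun_ab H \<alpha> \<beta> L z m"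
      by (simp_all only: m_fun_S_iff m_fun_ab_iff)
  next
    fix z m show "m_fun_S H \<alpha> z m \<longleftrightarrow> m_fun_ab H \<alpha> \<beta> L z m"
      by (simp only: m_fun_S_iff m_fun_ab_iff)
  qed (rule S_half_iff op_part_S_half)+
qed

end
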